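(* Let $1<p<\infty$ and let $\Omega\subset\mathbb{R}^n$ be a $W^{1,p}$-extension domain. Let $\gamma>0$ if $n\geq p$ and $\gamma\geq 1-n/p$ if $n<p$. Let $r\in(p,\infty]$ be given by $$ \frac{1}{\gamma+n/p} + \frac{p}{r} = 1 $$ (with $r=\infty$ if $\gamma+n/p=1$) and set $$ c_{n,p,\gamma} := \frac{(n/(p\gamma))^{n/(p\gamma)}}{(1+n/(p\gamma))^{1+n/(p\gamma)}}. $$ Then $$ \inf_{0\neq W \in L^{\gamma+n/p}(\Omega)} \frac{E(W) + 1}{\left(\int_\Omega W^{\gamma+n/p}\,dx\right)^{1/\gamma}} = -c_{n,p,\gamma} \left( S_r^\Omega \right)^{-\frac{p(\gamma+n/p)}{\gamma}}, $$ where the infimum is taken over all nonnegative functions $W\in L^{\gamma+n/p}(\Omega)$ that are not almost everywhere zero.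
   Context: A domain is a (nonempty) connected open set $\Omega\subset\mathbb{R}^n$. $W^{1,p}(\Omega)$ is the space of all functions in $L^p(\Omega)$ whose first order distributional derivatives belong to $L^p(\Omega)$, with norm $\|u\|_{W^{1,p}(\Omega)}=\left(\int_\Omega (|\nabla u|^p+|u|^p)\,dx\right)^{1/p}$. A $W^{1,p}(\Omega)$-extension operator is a map $E:W^{1,p}(\Omega)\to W^{1,p}(\mathbb{R}^n)$ (not assumed linear) with $E(u)|_\Omega = u$ for every $u\in W^{1,p}(\Omega)$. It is bounded if there is a constant $C\ge 1$ such that $\|E(u)\|_{W^{1,p}(\mathbb{R}^n)}\leq C\|u\|_{W^{1,p}(\Omega)}$ for all $u\in W^{1,p}(\Omega)$. A domain $\Omega$ is a $W^{1,p}$-extension domain if it admits a bounded $W^{1,p}(\Omega)$-extension operator. For a nonnegative measurable function $W$ on $\Omega$ (here the symbol $E(W)$ does not denote an extension operator), $$ E(W):= \inf_{0\not\equiv u\in W^{1,p}(\Omega)} \frac{\int_\Omega (|\nabla u|^p - W |u|^p)\,dx}{\int_\Omega |u|^p\,dx}. $$ Moreover, $$ S_{r}^\Omega := \inf_{0\neq u\in W^{1,p}(\Omega)} \frac{\|u\|_{W^{1,p}(\Omega)}^\theta \|u\|_{L^p(\Omega)}^{1-\theta}}{\| u\|_{L^r(\Omega)}}, $$ with $\theta=\theta(r)$ given by $\frac1p - \frac{\theta}{n} = \frac1r$ (where $1/r=0$ if $r=\infty$). *)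

theory Defs
  imports "HOL-Analysis.Analysis" "HOL-Probability.Essential_Supremum"
begin

definition domain :: "'a::euclidean_space set \<Rightarrow> bool" where
  "domain \<Omega> \<longleftrightarrow> open \<Omega> \<and> connected \<Omega> \<and> \<Omega> \<noteq> {}"

text \<open>Real powers of extended nonnegative reals, with \<open>0\<close> and \<open>\<infinity>\<close> exchanged by negative exponents.\<close>

definition ennpowr :: "ennreal \<Rightarrow> real \<Rightarrow> ennreal" where
  "ennpowr x a =
    (if a = 0 then 1
     else if x = 0 \<and> a < 0 \<or> x = \<infinity> \<and> 0 < a then \<infinity>
     else ennreal (enn2real x powr a))"

text \<open>
  Functions on \<open>\<Omega>\<close> are represented by functions on the whole space whose values outside \<open>\<Omega>\<close>
  are irrelevant, and Lebesgue and Sobolev functions by representatives of their classes modulo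
  null sets. Accordingly a function is nonzero if it does not vanish almost everywhere on \<open>\<Omega>\<close>.
\<close>

definition ae_zero :: "'a::euclidean_space set \<Rightarrow> ('a \<Rightarrow> real) \<Rightarrow> bool" where
  "ae_zero \<Omega> f \<longleftrightarrow> (AE x in lebesgue_on \<Omega>. f x = 0)"

definition Lp_norm ::
  "ennreal \<Rightarrow> 'a::euclidean_space set \<Rightarrow> ('a \<Rightarrow> 'b::euclidean_space) \<Rightarrow> ennreal" where
  "Lp_norm s \<Omega> f =
    (if s = \<infinity> then esssup (lebesgue_on \<Omega>) (\<lambda>x. ennreal (norm (f x)))
     else ennpowr (\<integral>\<^sup>+ x. ennreal (norm (f x) powr enn2real s) \<partial>lebesgue_on \<Omega>) (1 / enn2real s))"

definition Lp_space ::
  "ennreal \<Rightarrow> 'a::euclidean_space set \<Rightarrow> ('a \<Rightarrow> 'b::euclidean_space) set" where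
  "Lp_space s \<Omega> = {f \<in> borel_measurable (lebesgue_on \<Omega>). Lp_norm s \<Omega> f < \<infinity>}"

primrec Ck :: "nat \<Rightarrow> ('a::euclidean_space \<Rightarrow> real) \<Rightarrow> bool" where
  "Ck 0 f \<longleftrightarrow> continuous_on UNIV f"
| "Ck (Suc k) f \<longleftrightarrow>
    (\<forall>x. f differentiable at x) \<and> (\<forall>i\<in>Basis. Ck k (\<lambda>x. frechet_derivative f (at x) i))"

definition test_functions :: "'a::euclidean_space set \<Rightarrow> ('a \<Rightarrow> real) set" where
  "test_functions \<Omega> =
    {\<phi>. (\<forall>k. Ck k \<phi>) \<and> compact (closure {x. \<phi> x \<noteq> 0}) \<and> closure {x. \<phi> x \<noteq> 0} \<subseteq> \<Omega>}"

definition locally_integrable_on ::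
  "('a::euclidean_space \<Rightarrow> 'b::euclidean_space) \<Rightarrow> 'a set \<Rightarrow> bool" where
  "locally_integrable_on f \<Omega> \<longleftrightarrow>
    (\<forall>K. compact K \<and> K \<subseteq> \<Omega> \<longrightarrow> f absolutely_integrable_on K)"

text \<open>The component of \<open>g\<close> along \<open>i\<close> is the distributional partial derivative of \<open>u\<close> along \<open>i\<close>.\<close>

definition has_weak_gradient ::
  "'a::euclidean_space set \<Rightarrow> ('a \<Rightarrow> real) \<Rightarrow> ('a \<Rightarrow> 'a) \<Rightarrow> bool" where
  "has_weak_gradient \<Omega> u g \<longleftrightarrow>
    locally_integrable_on u \<Omega> \<and> locally_integrable_on g \<Omega> \<and>
    (\<forall>\<phi>\<in>test_functions \<Omega>. \<forall>i\<in>Basis.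
      (LINT x|lebesgue_on \<Omega>. u x * frechet_derivative \<phi> (at x) i)
        = - (LINT x|lebesgue_on \<Omega>. (g x \<bullet> i) * \<phi> x))"

definition sobolev_space :: "real \<Rightarrow> 'a::euclidean_space set \<Rightarrow> ('a \<Rightarrow> real) set" where
  "sobolev_space p \<Omega> =
    {u \<in> Lp_space (ennreal p) \<Omega>. \<exists>g. has_weak_gradient \<Omega> u g \<and> g \<in> Lp_space (ennreal p) \<Omega>}"

text \<open>
  The distributional gradient is determined only up to null sets, so a representative is chosen;
  everything below depends on its class only.
\<close>

definition weak_gradient ::
  "real \<Rightarrow> 'a::euclidean_space set \<Rightarrow> ('a \<Rightarrow> real) \<Rightarrow> 'a \<Rightarrow> 'a" where
  "weak_gradient p \<Omega> u = (SOME g. has_weak_gradient \<Omega> u g \<and> g \<in> Lp_space (ennreal p) \<Omega>)"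

definition sobolev_norm :: "real \<Rightarrow> 'a::euclidean_space set \<Rightarrow> ('a \<Rightarrow> real) \<Rightarrow> ennreal" where
  "sobolev_norm p \<Omega> u =
    ennpowr (\<integral>\<^sup>+ x. ennreal (norm (weak_gradient p \<Omega> u x) powr p + \<bar>u x\<bar> powr p) \<partial>lebesgue_on \<Omega>)
      (1 / p)"

text \<open>
  The second conjunct says that the operator is well defined on classes modulo null sets.
\<close>

definition extension_operator ::
  "real \<Rightarrow> 'a::euclidean_space set \<Rightarrow> (('a \<Rightarrow> real) \<Rightarrow> 'a \<Rightarrow> real) \<Rightarrow> bool" where
  "extension_operator p \<Omega> E \<longleftrightarrow>
    (\<forall>u\<in>sobolev_space p \<Omega>. E u \<in> sobolev_space p UNIV \<and> (AE x in lebesgue_on \<Omega>. E u x = u x)) \<and>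
    (\<forall>u\<in>sobolev_space p \<Omega>. \<forall>v\<in>sobolev_space p \<Omega>.
      (AE x in lebesgue_on \<Omega>. u x = v x) \<longrightarrow> (AE x in lebesgue. E u x = E v x))"

definition bounded_extension_operator ::
  "real \<Rightarrow> 'a::euclidean_space set \<Rightarrow> (('a \<Rightarrow> real) \<Rightarrow> 'a \<Rightarrow> real) \<Rightarrow> bool" where
  "bounded_extension_operator p \<Omega> E \<longleftrightarrow>
    extension_operator p \<Omega> E \<and>
    (\<exists>C\<ge>1. \<forall>u\<in>sobolev_space p \<Omega>. sobolev_norm p UNIV (E u) \<le> ennreal C * sobolev_norm p \<Omega> u)"

definition extension_domain :: "real \<Rightarrow> 'a::euclidean_space set \<Rightarrow> bool" where
  "extension_domain p \<Omega> \<longleftrightarrow> domain \<Omega> \<and> (\<exists>E. bounded_extension_operator p \<Omega> E)"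

text \<open>
  The Lebesgue integral with values in the extended reals; it is the usual one as soon as the
  positive or the negative part has finite integral.
\<close>

definition ext_integral :: "'a measure \<Rightarrow> ('a \<Rightarrow> real) \<Rightarrow> ereal" where
  "ext_integral M f =
    enn2ereal (\<integral>\<^sup>+ x. ennreal (f x) \<partial>M) - enn2ereal (\<integral>\<^sup>+ x. ennreal (- f x) \<partial>M)"

definition ground_energy ::
  "real \<Rightarrow> 'a::euclidean_space set \<Rightarrow> ('a \<Rightarrow> real) \<Rightarrow> ereal" where
  "ground_energy p \<Omega> W =
    (INF u\<in>{u \<in> sobolev_space p \<Omega>. \<not> ae_zero \<Omega> u}.
      ext_integral (lebesgue_on \<Omega>)
          (\<lambda>x. norm (weak_gradient p \<Omega> u x) powr p - W x * \<bar>u x\<bar> powr p)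
        / ext_integral (lebesgue_on \<Omega>) (\<lambda>x. \<bar>u x\<bar> powr p))"

text \<open>The solution \<open>\<theta>\<close> of \<open>1/p - \<theta>/n = 1/r\<close>; note that \<open>1/r = 0\<close> for \<open>r = \<infinity>\<close>.\<close>

definition sobolev_theta :: "nat \<Rightarrow> real \<Rightarrow> ennreal \<Rightarrow> real" where
  "sobolev_theta n p r = real n * (1 / p - enn2real (1 / r))"

definition sobolev_const :: "real \<Rightarrow> ennreal \<Rightarrow> 'a::euclidean_space set \<Rightarrow> ennreal" where
  "sobolev_const p r \<Omega> =
    (let \<theta> = sobolev_theta DIM('a) p r in
      INF u\<in>{u \<in> sobolev_space p \<Omega>. \<not> ae_zero \<Omega> u}.
        ennpowr (sobolev_norm p \<Omega> u) \<theta> * ennpowr (Lp_norm (ennreal p) \<Omega> u) (1 - \<theta>)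
          / Lp_norm r \<Omega> u)"

definition keller_const :: "nat \<Rightarrow> real \<Rightarrow> real \<Rightarrow> real" where
  "keller_const n p \<gamma> =
    (n / (p * \<gamma>)) powr (n / (p * \<gamma>)) / (1 + n / (p * \<gamma>)) powr (1 + n / (p * \<gamma>))"

end

theory Submission
  imports Defs
begin

text \<open>
  Both sides are the infimum of one functional of the pair \<open>(W, u)\<close>. Put \<open>q = \<gamma> + n/p\<close>,
  \<open>\<alpha> = n/(p\<gamma>)\<close>, so that \<open>q/\<gamma> = 1 + \<alpha>\<close>, and write \<open>A\<close>, \<open>D\<close>, \<open>B\<close> for the
  \<open>p\<close>-th powers of the \<open>W\<^sup>1\<^sup>,\<^sup>p\<close>, \<open>L\<^sup>p\<close> and \<open>L\<^sup>r\<close> norms of \<open>u\<close>. For fixed \<open>u\<close> and fixed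
  \<open>t\<close>, the \<open>L\<^sup>q\<close> norm of \<open>W\<close>, Hoelder's inequality makes \<open>t B\<close> the sharp bound for the potential
  term, so that it remains to minimise \<open>(A - t B) / (D t powr (1 + \<alpha>))\<close> over \<open>t\<close>. The minimum is
  \<open>- c A powr (-\<alpha>) B powr (1 + \<alpha>) / D\<close>, which is \<open>- c\<close> times the required power of the Sobolev
  quotient of \<open>u\<close>.

  If \<open>B = \<infinity>\<close>, truncations of \<open>u\<close> take the place of the extremal potential and both sides
  are \<open>- \<infinity>\<close>.
\<close>

subsection \<open>Minimisation in the size of the potential\<close>

text \<open>The constant \<open>keller_const\<close> as a function of \<alpha> = n/(p\<gamma>), the
  only combination of the parameters that the minimisation sees.\<close>

abbreviation keller_factor :: "real \<Rightarrow> real" where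
  "keller_factor \<alpha> \<equiv> \<alpha> powr \<alpha> / (1 + \<alpha>) powr (1 + \<alpha>)"

text \<open>The chosen \<open>t\<close> is the zero of the derivative of
  \<open>(A - t * B) / t powr (1 + \<alpha>)\<close>, that is, the solution of
  \<open>\<alpha> * t * B = (1 + \<alpha>) * A\<close>. There the numerator collapses to
  \<open>- A / \<alpha>\<close>.\<close>

lemma keller_optimum:
  fixes \<alpha> A B :: real
  assumes "0 < \<alpha>" "0 < A" "0 < B"
  defines "t \<equiv> (1 + \<alpha>) * A / (\<alpha> * B)"
  shows "(A - t * B) / t powr (1 + \<alpha>)
    = - (keller_factor \<alpha> * (A powr - \<alpha> * B powr (1 + \<alpha>)))"
proof -
  have "A - t * B = - A / \<alpha>"
    using assms by (simp add: field_simps)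
  moreover have "t powr (1 + \<alpha>)
      = (1 + \<alpha>) powr (1 + \<alpha>) * (A * A powr \<alpha>) / (\<alpha> * \<alpha> powr \<alpha> * B powr (1 + \<alpha>))"
    using assms by (simp add: powr_divide powr_mult powr_add ac_simps)
  ultimately have "(A - t * B) / t powr (1 + \<alpha>) = (- A / \<alpha>) /
      ((1 + \<alpha>) powr (1 + \<alpha>) * (A * A powr \<alpha>) / (\<alpha> * \<alpha> powr \<alpha> * B powr (1 + \<alpha>)))"
    by simp
  also have "\<dots> = - (keller_factor \<alpha> * (A powr - \<alpha> * B powr (1 + \<alpha>)))"
    using assms(1-3) by (simp add: powr_minus field_simps)
  finally show ?thesis .
qed

text \<open>Measuring \<open>t\<close> in units of the critical point,
  \<open>t = h * \<tau>\<close>, reduces the claim to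
  \<open>h * (1 + \<alpha>) \<le> h powr (1 + \<alpha>) + \<alpha>\<close>. This is Young's
  inequality for the product of \<open>h\<close> and 1 with exponents \<open>1 + \<alpha>\<close>
  and \<open>(1 + \<alpha>) / \<alpha>\<close>.\<close>

lemma keller_lower_bound:
  fixes \<alpha> A B t :: real
  assumes "0 < \<alpha>" "0 < A" "0 < B" "0 < t"
  shows "- (keller_factor \<alpha> * (A powr - \<alpha> * B powr (1 + \<alpha>)))
    \<le> (A - t * B) / t powr (1 + \<alpha>)"
proof -
  define \<tau> where "\<tau> = (1 + \<alpha>) * A / (\<alpha> * B)"
  define h where "h = t / \<tau>"
  have pos: "0 < \<tau>" "0 < h" and t: "t = h * \<tau>"
    using assms by (auto simp: \<tau>_def h_def)
  have "h * 1 \<le> h powr (1 + \<alpha>) / (1 + \<alpha>) + 1 powr ((1 + \<alpha>) / \<alpha>) / ((1 + \<alpha>) / \<alpha>)"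
    using assms pos by (intro Youngs_inequality) (auto simp: field_simps)
  also have "\<dots> = (h powr (1 + \<alpha>) + \<alpha>) / (1 + \<alpha>)"
    using assms by (auto simp: divide_simps)
  finally have "h \<le> (h powr (1 + \<alpha>) + \<alpha>) / (1 + \<alpha>)"
    by simp
  then have "h * (1 + \<alpha>) \<le> h powr (1 + \<alpha>) + \<alpha>"
    using assms by (simp add: pos_le_divide_eq)
  \<comment> \<open>The factor \<open>A / \<alpha>\<close> equals \<open>\<tau> * B - A\<close>,
    which brings the scalar inequality back to the original quantities.\<close>
  then have "(A / \<alpha>) * (h * (1 + \<alpha>)) \<le> (A / \<alpha>) * (h powr (1 + \<alpha>) + \<alpha>)"
    using assms by (intro mult_left_mono) auto
  moreover have "t * B = (A / \<alpha>) * (h * (1 + \<alpha>))"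
    using assms by (simp add: t \<tau>_def)
  moreover have "(A / \<alpha>) * (h powr (1 + \<alpha>) + \<alpha>) = A - h powr (1 + \<alpha>) * (A - \<tau> * B)"
    using assms by (simp add: \<tau>_def field_simps)
  ultimately have "h powr (1 + \<alpha>) * (A - \<tau> * B) \<le> A - t * B"
    by linarith
  then have "(h powr (1 + \<alpha>) * (A - \<tau> * B)) / t powr (1 + \<alpha>) \<le> (A - t * B) / t powr (1 + \<alpha>)"
    by (intro divide_right_mono) auto
  also have "(h powr (1 + \<alpha>) * (A - \<tau> * B)) / t powr (1 + \<alpha>) = (A - \<tau> * B) / \<tau> powr (1 + \<alpha>)"
    using pos by (simp add: t powr_mult)
  finally have "(A - \<tau> * B) / \<tau> powr (1 + \<alpha>) \<le> (A - t * B) / t powr (1 + \<alpha>)" .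
  then show ?thesis
    using keller_optimum[OF assms(1-3)] by (simp add: \<tau>_def)
qed

subsection \<open>Sharpness of Hoelder's inequality\<close>

text \<open>Young's inequality with exponents \<open>q\<close> and \<open>q / (q - 1)\<close> is
  applied pointwise to the normalised functions \<open>W / t\<close> and
  \<open>\<bar>u\<bar> powr p / N powr p\<close>, then integrated. The conjugate exponent turns the
  \<open>p\<close>-th power of \<open>u\<close> into the \<open>\<rho>\<close>-th.\<close>

lemma nn_integral_Hoelder_power:
  fixes u W :: "'a \<Rightarrow> real"
  assumes [measurable]: "u \<in> borel_measurable M" "W \<in> borel_measurable M"
    and W: "\<And>x. x \<in> space M \<Longrightarrow> 0 \<le> W x"
    and "0 < p" "1 < q" "\<rho> = p * q / (q - 1)" "0 < t" "0 < N"
    and t: "(\<integral>\<^sup>+x. ennreal (W x powr q) \<partial>M) = ennreal (t powr q)"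
    and N: "(\<integral>\<^sup>+x. ennreal (\<bar>u x\<bar> powr \<rho>) \<partial>M) = ennreal (N powr \<rho>)"
  shows "(\<integral>\<^sup>+x. ennreal (W x * \<bar>u x\<bar> powr p) \<partial>M) \<le> ennreal (t * N powr p)"
proof -
  \<comment> \<open>These are the Young weights \<open>1 / q\<close> and \<open>(q - 1) / q\<close>
    with the normalisation undone. After integration the two terms contribute exactly these
    fractions of \<open>t * N powr p\<close>.\<close>
  define c d where "c = t * N powr p / (q * t powr q)"
    and "d = t * N powr p * (q - 1) / (q * N powr \<rho>)"
  have cd: "0 \<le> c" "0 \<le> d"
    using assms by (auto simp: c_def d_def)
  have "W x * \<bar>u x\<bar> powr p \<le> c * W x powr q + d * \<bar>u x\<bar> powr \<rho>" if "x \<in> space M" for x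
  proof -
    have "(W x / t) * (\<bar>u x\<bar> powr p / N powr p) \<le> (W x / t) powr q / q
        + (\<bar>u x\<bar> powr p / N powr p) powr (q / (q - 1)) / (q / (q - 1))"
      using assms W[OF that] by (intro Youngs_inequality) (auto simp: field_simps)
    then have "(t * N powr p) * ((W x / t) * (\<bar>u x\<bar> powr p / N powr p)) \<le> (t * N powr p) *
       ((W x / t) powr q / q + (\<bar>u x\<bar> powr p / N powr p) powr (q / (q - 1)) / (q / (q - 1)))"
      using assms by (intro mult_left_mono) auto
    also have "(t * N powr p) * ((W x / t) * (\<bar>u x\<bar> powr p / N powr p)) = W x * \<bar>u x\<bar> powr p"
      using assms by simp
    also have "(t * N powr p) *
       ((W x / t) powr q / q + (\<bar>u x\<bar> powr p / N powr p) powr (q / (q - 1)) / (q / (q - 1)))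
       = c * W x powr q + d * \<bar>u x\<bar> powr \<rho>"
      using assms W[OF that] unfolding c_def d_def
      by (simp add: powr_divide powr_powr algebra_simps)
    finally show ?thesis .
  qed
  then have "(\<integral>\<^sup>+x. ennreal (W x * \<bar>u x\<bar> powr p) \<partial>M)
      \<le> (\<integral>\<^sup>+x. ennreal c * ennreal (W x powr q) + ennreal d * ennreal (\<bar>u x\<bar> powr \<rho>) \<partial>M)"
    using cd by (intro nn_integral_mono) (auto simp flip: ennreal_mult ennreal_plus)
  also have "\<dots> = ennreal (c * t powr q + d * N powr \<rho>)"
    using cd by (simp add: nn_integral_add nn_integral_cmult t N ennreal_mult)
  also have "c * t powr q + d * N powr \<rho> = t * N powr p"
    using assms by (simp add: c_def d_def field_simps)
  finally show ?thesis .
qed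

text \<open>Equality in Hoelder's inequality needs \<open>W powr q\<close> proportional to
  \<open>\<bar>u\<bar> powr \<rho>\<close>. Since the integral of the latter may be infinite, the
  potential is built from a truncation of \<open>u\<close>, at the price of reaching only values
  \<open>b\<close> below the norm.\<close>

lemma exists_nn_integral_Hoelder_power:
  fixes u :: "'a \<Rightarrow> real"
  assumes [measurable]: "u \<in> borel_measurable M"
    and "0 < p" "1 < q" and \<rho>: "\<rho> = p * q / (q - 1)" and "0 < b"
    and fin: "(\<integral>\<^sup>+x. ennreal (\<bar>u x\<bar> powr p) \<partial>M) < \<infinity>"
    and b: "ennreal (b powr \<rho>) < (\<integral>\<^sup>+x. ennreal (\<bar>u x\<bar> powr \<rho>) \<partial>M)"
  shows "\<exists>W\<in>borel_measurable M. (\<forall>x. 0 \<le> W x) \<and> (\<integral>\<^sup>+x. ennreal (W x powr q) \<partial>M) = 1 \<and>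
    ennreal (b powr p) \<le> (\<integral>\<^sup>+x. ennreal (W x * \<bar>u x\<bar> powr p) \<partial>M)"
proof -
  define v where "v k x = min \<bar>u x\<bar> (real k)" for k x
  have [measurable]: "v k \<in> borel_measurable M" for k
    unfolding v_def by measurable
  have v: "0 \<le> v k x" "v k x \<le> \<bar>u x\<bar>" "v k x \<le> k" for k x
    by (auto simp: v_def)
  have \<rho>pos: "0 < \<rho>" "p < \<rho>"
    using assms(2,3) by (auto simp: \<rho> pos_less_divide_eq algebra_simps)
  have "(SUP k. ennreal (v k x powr \<rho>)) = ennreal (\<bar>u x\<bar> powr \<rho>)" for x
  proof (rule antisym)
    show "(SUP k. ennreal (v k x powr \<rho>)) \<le> ennreal (\<bar>u x\<bar> powr \<rho>)"
      using v \<rho>pos by (intro SUP_least ennreal_leI powr_mono2) auto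
    obtain k :: nat where "\<bar>u x\<bar> \<le> real k"
      using real_arch_simple by blast
    then have "v k x = \<bar>u x\<bar>"
      by (auto simp: v_def)
    then show "ennreal (\<bar>u x\<bar> powr \<rho>) \<le> (SUP k. ennreal (v k x powr \<rho>))"
      by (metis SUP_upper UNIV_I)
  qed
  moreover have "incseq (\<lambda>k x. ennreal (v k x powr \<rho>))"
    using \<rho>pos by (auto simp: incseq_def le_fun_def v_def intro!: ennreal_leI powr_mono2)
  ultimately have "(\<integral>\<^sup>+x. ennreal (\<bar>u x\<bar> powr \<rho>) \<partial>M) = (SUP k. \<integral>\<^sup>+x. ennreal (v k x powr \<rho>) \<partial>M)"
    using nn_integral_monotone_convergence_SUP[of "\<lambda>k x. ennreal (v k x powr \<rho>)" M] by simp
  then obtain k where k: "ennreal (b powr \<rho>) < (\<integral>\<^sup>+x. ennreal (v k x powr \<rho>) \<partial>M)"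
    using b by (auto simp: less_SUP_iff)
  have "(\<integral>\<^sup>+x. ennreal (v k x powr \<rho>) \<partial>M)
      \<le> (\<integral>\<^sup>+x. ennreal (real k powr (\<rho> - p)) * ennreal (\<bar>u x\<bar> powr p) \<partial>M)"
  proof (intro nn_integral_mono)
    fix x
    \<comment> \<open>One factor is bounded by the truncation height and the other is integrable by
      \<open>fin\<close>, so the truncated integral is a finite number \<open>i\<close>.\<close>
    have "v k x powr \<rho> = v k x powr (\<rho> - p) * v k x powr p"
      by (simp flip: powr_add)
    also have "\<dots> \<le> real k powr (\<rho> - p) * \<bar>u x\<bar> powr p"
      using v[of k x] assms \<rho>pos by (intro mult_mono powr_mono2) auto
    finally show "ennreal (v k x powr \<rho>) \<le> ennreal (real k powr (\<rho> - p)) * ennreal (\<bar>u x\<bar> powr p)"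
      by (simp flip: ennreal_mult)
  qed
  also have "\<dots> < \<infinity>"
    using fin by (simp add: nn_integral_cmult ennreal_mult_less_top)
  finally obtain i where i: "(\<integral>\<^sup>+x. ennreal (v k x powr \<rho>) \<partial>M) = ennreal i" "0 \<le> i"
    by (cases "\<integral>\<^sup>+x. ennreal (v k x powr \<rho>) \<partial>M") auto
  then have bi: "b powr \<rho> < i"
    using k by (simp add: ennreal_less_iff)
  then have ipos: "0 < i"
    by (meson le_less_trans powr_ge_zero)
  \<comment> \<open>The equality case for the truncation: \<open>W powr q\<close> is
    \<open>v k powr \<rho>\<close> divided by its integral \<open>i\<close>.\<close>
  define W where "W x = i powr (- 1 / q) * v k x powr (p / (q - 1))" for x
  have [measurable]: "W \<in> borel_measurable M"
    unfolding W_def by measurable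
  have "(i powr (- 1 / q)) powr q = inverse i"
    using assms ipos unfolding powr_powr by (simp add: powr_minus)
  then have "W x powr q = inverse i * v k x powr \<rho>" for x
    using assms ipos v[of k x] unfolding W_def
    by (simp add: powr_mult powr_powr \<rho>)
  then have "(\<integral>\<^sup>+x. ennreal (W x powr q) \<partial>M) = ennreal (inverse i) * (\<integral>\<^sup>+x. ennreal (v k x powr \<rho>) \<partial>M)"
    using ipos by (simp add: ennreal_mult nn_integral_cmult)
  also have "\<dots> = 1"
    using ipos unfolding i by (simp flip: ennreal_mult)
  finally have 1: "(\<integral>\<^sup>+x. ennreal (W x powr q) \<partial>M) = 1" .
  \<comment> \<open>Pairing \<open>W\<close> with \<open>v k powr p\<close> gives
    \<open>i powr (1 - 1 / q)\<close>, and \<open>\<rho> * (1 - 1 / q) = p\<close> compares this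
    with \<open>b powr p\<close>.\<close>
  have "1 - 1 / q = (q - 1) / q"
    using assms by (simp add: field_simps)
  then have "b powr p = (b powr \<rho>) powr (1 - 1 / q)"
    using assms by (simp add: powr_powr \<rho>)
  also have "\<dots> \<le> i powr (1 - 1 / q)"
    using bi assms by (intro powr_mono2) auto
  finally have "ennreal (b powr p) \<le> ennreal (i powr (- 1 / q) * i)"
    using ipos by (simp add: powr_diff powr_minus field_simps)
  also have "\<dots> = (\<integral>\<^sup>+x. ennreal (i powr (- 1 / q) * v k x powr \<rho>) \<partial>M)"
    using ipos by (simp add: ennreal_mult nn_integral_cmult i)
  also have "\<dots> \<le> (\<integral>\<^sup>+x. ennreal (W x * \<bar>u x\<bar> powr p) \<partial>M)"
  proof (intro nn_integral_mono ennreal_leI)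
    fix x
    have "p / (q - 1) + p = \<rho>"
      using assms by (simp add: field_simps)
    then have "v k x powr \<rho> = v k x powr (p / (q - 1)) * v k x powr p"
      by (simp flip: powr_add)
    also have "\<dots> \<le> v k x powr (p / (q - 1)) * \<bar>u x\<bar> powr p"
      using v[of k x] assms by (intro mult_left_mono powr_mono2) auto
    finally show "i powr (- 1 / q) * v k x powr \<rho> \<le> W x * \<bar>u x\<bar> powr p"
      unfolding W_def mult.assoc by (intro mult_left_mono) auto
  qed
  finally show ?thesis
    using 1 by (intro bexI[of _ W]) (auto simp: W_def)
qed

text \<open>The endpoint \<open>q = 1\<close> of the previous bound, where the conjugate norm of
  \<open>u\<close> is the essential supremum.\<close>

lemma nn_integral_le_esssup_power:
  fixes u W :: "'a \<Rightarrow> real"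
  assumes [measurable]: "u \<in> borel_measurable M" "W \<in> borel_measurable M"
    and W: "\<And>x. x \<in> space M \<Longrightarrow> 0 \<le> W x"
    and "0 < p" "0 \<le> t" "0 \<le> N"
    and t: "(\<integral>\<^sup>+x. ennreal (W x) \<partial>M) = ennreal t"
    and N: "esssup M (\<lambda>x. ennreal \<bar>u x\<bar>) = ennreal N"
  shows "(\<integral>\<^sup>+x. ennreal (W x * \<bar>u x\<bar> powr p) \<partial>M) \<le> ennreal (t * N powr p)"
proof -
  have "AE x in M. \<bar>u x\<bar> \<le> N"
    using esssup_AE[where M = M and f = "\<lambda>x. ennreal \<bar>u x\<bar>"] \<open>0 \<le> N\<close> by (simp add: N)
  then have "AE x in M. ennreal (W x * \<bar>u x\<bar> powr p) \<le> ennreal (N powr p) * ennreal (W x)"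
    using AE_space
  proof eventually_elim
    case (elim x)
    have "W x * \<bar>u x\<bar> powr p \<le> W x * N powr p"
      using elim W assms by (intro mult_left_mono powr_mono2) auto
    then show ?case
      using W elim by (simp add: mult.commute flip: ennreal_mult)
  qed
  then have "(\<integral>\<^sup>+x. ennreal (W x * \<bar>u x\<bar> powr p) \<partial>M)
      \<le> (\<integral>\<^sup>+x. ennreal (N powr p) * ennreal (W x) \<partial>M)"
    by (rule nn_integral_mono_AE)
  also have "\<dots> = ennreal (t * N powr p)"
    using assms by (subst mult.commute[of t]) (simp add: nn_integral_cmult t ennreal_mult)
  finally show ?thesis .
qed

text \<open>At the endpoint \<open>q = 1\<close> a nearly extremal potential lives where
  \<open>\<bar>u\<bar>\<close> is nearly maximal: it is the normalised indicator of the superlevel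
  set at height \<open>b\<close>, which is not null because \<open>b\<close> lies below the
  essential supremum.\<close>

lemma exists_nn_integral_esssup_power:
  fixes u :: "'a \<Rightarrow> real"
  assumes [measurable]: "u \<in> borel_measurable M"
    and "0 < p" "0 < b"
    and fin: "(\<integral>\<^sup>+x. ennreal (\<bar>u x\<bar> powr p) \<partial>M) < \<infinity>"
    and b: "ennreal b < esssup M (\<lambda>x. ennreal \<bar>u x\<bar>)"
  shows "\<exists>W\<in>borel_measurable M. (\<forall>x. 0 \<le> W x) \<and> (\<integral>\<^sup>+x. ennreal (W x) \<partial>M) = 1 \<and>
    ennreal (b powr p) \<le> (\<integral>\<^sup>+x. ennreal (W x * \<bar>u x\<bar> powr p) \<partial>M)"
proof -
  define S where "S = {x \<in> space M. b < \<bar>u x\<bar>}"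
  have S[measurable]: "S \<in> sets M"
    unfolding S_def by measurable
  have "emeasure M S \<noteq> 0"
  proof
    assume "emeasure M S = 0"
    then have "AE x in M. x \<notin> S"
      by (intro AE_not_in) auto
    then have "AE x in M. ennreal \<bar>u x\<bar> \<le> ennreal b"
      using AE_space by eventually_elim (auto simp: S_def intro: ennreal_leI)
    then have "esssup M (\<lambda>x. ennreal \<bar>u x\<bar>) \<le> ennreal b"
      by (intro esssup_I) auto
    with b show False
      by simp
  qed
  \<comment> \<open>Chebyshev's inequality. It serves twice: it makes the measure of
    \<open>S\<close> finite, so that the indicator can be normalised, and it gives the final lower
    bound.\<close>
  have le: "ennreal (b powr p) * emeasure M S \<le> (\<integral>\<^sup>+x. ennreal (indicator S x * \<bar>u x\<bar> powr p) \<partial>M)"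
  proof -
    have "ennreal (b powr p) * emeasure M S = (\<integral>\<^sup>+x. ennreal (b powr p) * indicator S x \<partial>M)"
      by (simp add: nn_integral_cmult_indicator)
    also have "\<dots> \<le> (\<integral>\<^sup>+x. ennreal (indicator S x * \<bar>u x\<bar> powr p) \<partial>M)"
      using assms by (intro nn_integral_mono)
        (auto simp: S_def split: split_indicator intro!: ennreal_leI powr_mono2)
    finally show ?thesis .
  qed
  also have "\<dots> \<le> (\<integral>\<^sup>+x. ennreal (\<bar>u x\<bar> powr p) \<partial>M)"
    by (intro nn_integral_mono ennreal_leI) (auto split: split_indicator)
  also have "\<dots> < \<infinity>"
    by (rule fin)
  finally have "emeasure M S \<noteq> \<infinity>"
    using \<open>0 < b\<close> by (auto simp: ennreal_mult_eq_top_iff)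
  then obtain m where m: "emeasure M S = ennreal m" "0 < m"
    using \<open>emeasure M S \<noteq> 0\<close> by (cases "emeasure M S") (auto simp: order_less_le)
  define W :: "'a \<Rightarrow> real" where "W x = inverse m * indicator S x" for x
  have [measurable]: "W \<in> borel_measurable M"
    unfolding W_def by measurable
  have "(\<integral>\<^sup>+x. ennreal (W x) \<partial>M) = (\<integral>\<^sup>+x. ennreal (inverse m) * indicator S x \<partial>M)"
    using m by (intro nn_integral_cong) (auto simp: W_def split: split_indicator)
  also have "\<dots> = 1"
    using m by (simp add: nn_integral_cmult_indicator flip: ennreal_mult)
  finally have 1: "(\<integral>\<^sup>+x. ennreal (W x) \<partial>M) = 1" .
  have "ennreal (b powr p) = ennreal (inverse m) * (ennreal (b powr p) * emeasure M S)"
    using m by (simp flip: ennreal_mult)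
  also have "\<dots> \<le> ennreal (inverse m) * (\<integral>\<^sup>+x. ennreal (indicator S x * \<bar>u x\<bar> powr p) \<partial>M)"
    by (intro mult_left_mono le) simp
  also have "\<dots> = (\<integral>\<^sup>+x. ennreal (W x * \<bar>u x\<bar> powr p) \<partial>M)"
    using m by (simp add: W_def ennreal_mult mult.assoc flip: nn_integral_cmult)
  finally show ?thesis
    using 1 m by (intro bexI[of _ W]) (auto simp: W_def)
qed

subsection \<open>Nonzero Sobolev functions\<close>

lemma integrable_lborel_continuous_support_cball:
  fixes f :: "'a::euclidean_space \<Rightarrow> 'b::{banach, second_countable_topology}"
  assumes "continuous_on UNIV f" "\<And>x. x \<notin> cball c R \<Longrightarrow> f x = 0"
  shows "integrable lborel f"
proof -
  have "integrable lborel (\<lambda>x. indicator (cball c R) x *\<^sub>R f x)"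
    using assms by (intro borel_integrable_compact) (auto intro: continuous_on_subset)
  also have "(\<lambda>x. indicator (cball c R) x *\<^sub>R f x) = f"
    using assms(2) by (auto simp: indicator_def fun_eq_iff)
  finally show ?thesis .
qed

lemma bounded_continuous_support_cball:
  fixes f :: "'a::euclidean_space \<Rightarrow> 'b::real_normed_vector"
  assumes "continuous_on UNIV f" "\<And>x. x \<notin> cball c R \<Longrightarrow> f x = 0"
  obtains B where "0 < B" "\<And>x. norm (f x) \<le> B"
proof -
  have "bounded (f ` cball c R)"
    using assms by (intro compact_imp_bounded compact_continuous_image)
      (auto intro: continuous_on_subset)
  then obtain B where B: "0 < B" "\<And>x. x \<in> cball c R \<Longrightarrow> norm (f x) \<le> B"
    unfolding bounded_pos by auto
  then have "norm (f x) \<le> B" for x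
    using assms(2)[of x] by (cases "x \<in> cball c R") auto
  with B that show ?thesis
    by blast
qed

lemma lborel_integral_translate:
  fixes f :: "'a::euclidean_space \<Rightarrow> real"
  assumes [measurable]: "f \<in> borel_measurable borel"
  shows "(LINT x|lborel. f (v + x)) = (LINT x|lborel. f x)"
    and "integrable lborel (\<lambda>x. f (v + x)) \<longleftrightarrow> integrable lborel f"
proof -
  have d: "distr lborel borel ((+) v) = (lborel :: 'a measure)"
    by (simp add: lborel_distr_plus)
  have "(LINT x|lborel. f (v + x)) = (LINT x|distr lborel borel ((+) v). f x)"
    by (subst integral_distr) auto
  then show "(LINT x|lborel. f (v + x)) = (LINT x|lborel. f x)"
    by (simp add: d)
  have "integrable (distr lborel borel ((+) v)) f \<longleftrightarrow> integrable lborel (\<lambda>x. f (v + x))"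
    by (subst integrable_distr_eq) auto
  then show "integrable lborel (\<lambda>x. f (v + x)) \<longleftrightarrow> integrable lborel f"
    by (simp add: d)
qed

text \<open>The difference quotients of \<open>h\<close> along \<open>b\<close> have integral zero by translation invariance.\<close>

lemma lborel_integral_derivative_eq_0:
  fixes h :: "'a::euclidean_space \<Rightarrow> real"
  assumes der: "\<And>x. (h has_derivative D x) (at x)"
    and cont: "continuous_on UNIV (\<lambda>x. D x b)"
    and h0: "\<And>x. x \<notin> cball c R \<Longrightarrow> h x = 0"
    and D0: "\<And>x. x \<notin> cball c R \<Longrightarrow> D x b = 0"
  shows "(LINT x|lborel. D x b) = 0"
proof -
  obtain B where B: "0 < B" "\<And>x. norm (D x b) \<le> B"
    using bounded_continuous_support_cball[OF cont D0] by blast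
  have hcont: "continuous_on UNIV h"
    using der by (meson continuous_at_imp_continuous_on has_derivative_continuous)
  have [measurable]: "h \<in> borel_measurable borel" "(\<lambda>x. D x b) \<in> borel_measurable borel"
    using hcont cont by (auto intro: borel_measurable_continuous_onI)
  have hint: "integrable lborel h"
    using hcont h0 by (rule integrable_lborel_continuous_support_cball)
  have line: "((\<lambda>s. h (s *\<^sub>R b + x)) has_real_derivative D (s *\<^sub>R b + x) b) (at s)" for x s
  proof -
    have "((\<lambda>s. h (s *\<^sub>R b + x)) has_derivative (\<lambda>s'. D (s *\<^sub>R b + x) (s' *\<^sub>R b))) (at s)"
      by (rule has_derivative_compose[OF _ der]) (auto intro!: derivative_eq_intros)
    moreover have "(\<lambda>s'. D (s *\<^sub>R b + x) (s' *\<^sub>R b)) = (*) (D (s *\<^sub>R b + x) b)"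
      using has_derivative_linear[OF der] by (auto simp: linear_scale mult.commute)
    ultimately show ?thesis
      by (simp add: has_field_derivative_def)
  qed
  define \<epsilon> where "\<epsilon> k = inverse (real (Suc k))" for k
  have \<epsilon>: "0 < \<epsilon> k" "\<epsilon> k \<le> 1" for k
    by (auto simp: \<epsilon>_def field_simps)
  define f where "f k x = (h (\<epsilon> k *\<^sub>R b + x) - h x) / \<epsilon> k" for k x
  have [measurable]: "f k \<in> borel_measurable borel" for k
    unfolding f_def by measurable
  have lim: "(\<lambda>k. f k x) \<longlonglongrightarrow> D x b" for x
  proof -
    have "((\<lambda>s. (h ((0 + s) *\<^sub>R b + x) - h (0 *\<^sub>R b + x)) / s) \<longlongrightarrow> D (0 *\<^sub>R b + x) b) (at 0)"
      using line[of x 0] unfolding DERIV_def .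
    moreover have "filterlim \<epsilon> (at 0) sequentially"
      using LIMSEQ_inverse_real_of_nat \<epsilon>(1) unfolding \<epsilon>_def[abs_def]
      by (intro filterlim_atI) auto
    ultimately show ?thesis
      unfolding f_def using filterlim_compose by fastforce
  qed
  \<comment> \<open>The mean value theorem bounds the difference quotients by \<open>B\<close>. As
    \<open>\<epsilon> k \<le> 1\<close>, shifts move the support by at most \<open>norm b\<close>,
    so a single enlarged ball dominates all of them.\<close>
  have bound: "norm (f k x) \<le> B * indicator (cball c (R + norm b)) x" for k x
  proof (cases "x \<in> cball c (R + norm b)")
    case True
    obtain z where "h (\<epsilon> k *\<^sub>R b + x) - h (0 *\<^sub>R b + x) = (\<epsilon> k - 0) * D (z *\<^sub>R b + x) b"
      using MVT2[OF \<epsilon>(1)[of k] line[of x]] by blast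
    then have "f k x = D (z *\<^sub>R b + x) b"
      using \<epsilon>(1)[of k] by (simp add: f_def)
    then show ?thesis
      using True B by simp
  next
    case False
    have "norm (\<epsilon> k *\<^sub>R b) \<le> norm b"
      using \<epsilon>[of k] by (simp add: mult_left_le_one_le)
    moreover have "dist c x \<le> dist c (\<epsilon> k *\<^sub>R b + x) + norm (\<epsilon> k *\<^sub>R b)"
      using dist_triangle[of c x "\<epsilon> k *\<^sub>R b + x"] by (simp add: dist_norm)
    ultimately have "\<epsilon> k *\<^sub>R b + x \<notin> cball c R" "x \<notin> cball c R"
      using False norm_ge_zero[of b] unfolding mem_cball by linarith+
    then show ?thesis
      using h0 False by (simp add: f_def)
  qed
  have "(\<lambda>k. LINT x|lborel. f k x) \<longlonglongrightarrow> (LINT x|lborel. D x b)"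
  proof (rule integral_dominated_convergence)
    show "integrable lborel (\<lambda>x. B * indicator (cball c (R + norm b)) x)"
      using emeasure_lborel_cball_finite[of c "R + norm b"] by (auto simp: less_top)
  qed (use lim bound in auto)
  moreover have "(LINT x|lborel. f k x) = 0" for k
    unfolding f_def using hint by (simp add: lborel_integral_translate)
  ultimately show ?thesis
    by (simp add: LIMSEQ_const_iff)
qed

text \<open>Squaring removes the kink of the positive part at 0, which makes the bump below
  continuously differentiable across its boundary sphere.\<close>

lemma has_real_derivative_max_0_power2:
  fixes s :: real
  shows "((\<lambda>s. (max 0 s)\<^sup>2) has_real_derivative 2 * max 0 s) (at s)"
proof (cases s "0 :: real" rule: linorder_cases)
  case less
  have "((\<lambda>s. 0) has_real_derivative 2 * max 0 s) (at s)"
    using less by simp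
  then show ?thesis
    by (rule has_field_derivative_transform_within_open[of _ _ _ "{..<0}"]) (use less in auto)
next
  case greater
  have "((\<lambda>s. s\<^sup>2) has_real_derivative 2 * max 0 s) (at s)"
    using greater by (auto intro!: derivative_eq_intros)
  then show ?thesis
    by (rule has_field_derivative_transform_within_open[of _ _ _ "{0<..}"]) (use greater in auto)
next
  case equal
  have "((\<lambda>h. (max 0 h)\<^sup>2 / h) \<longlongrightarrow> 0) (at (0::real))"
  proof (rule Lim_null_comparison)
    show "\<forall>\<^sub>F h in at 0. norm ((max 0 h)\<^sup>2 / h) \<le> \<bar>h :: real\<bar>"
      by (intro always_eventually) (auto simp: max_def power2_eq_square)
    show "((\<lambda>h. \<bar>h\<bar>) \<longlongrightarrow> 0) (at (0::real))"
      by (auto intro!: tendsto_eq_intros)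
  qed
  then show ?thesis
    by (simp add: DERIV_def equal)
qed

text \<open>A squared positive part in place of a smooth cutoff: one continuous derivative is enough
  for a weak gradient, and the gradient stays explicit.\<close>

definition bump :: "'a::euclidean_space \<Rightarrow> real \<Rightarrow> 'a \<Rightarrow> real" where
  "bump c R x = (max 0 (R\<^sup>2 - (x - c) \<bullet> (x - c)))\<^sup>2"

definition bump_gradient :: "'a::euclidean_space \<Rightarrow> real \<Rightarrow> 'a \<Rightarrow> 'a" where
  "bump_gradient c R x = (- 4 * max 0 (R\<^sup>2 - (x - c) \<bullet> (x - c))) *\<^sub>R (x - c)"

lemma has_derivative_bump:
  "(bump c R has_derivative (\<lambda>v. bump_gradient c R x \<bullet> v)) (at x)"
proof -
  have "((\<lambda>x. R\<^sup>2 - (x - c) \<bullet> (x - c)) has_derivative (\<lambda>v. - 2 * ((x - c) \<bullet> v))) (at x)"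
    by (auto intro!: derivative_eq_intros simp: inner_commute)
  from has_derivative_compose[OF this
      has_real_derivative_max_0_power2[unfolded has_field_derivative_def]]
  show ?thesis
    by (simp add: bump_def[abs_def] bump_gradient_def algebra_simps)
qed

lemma continuous_on_bump: "continuous_on S (bump c R)" "continuous_on S (bump_gradient c R)"
  unfolding bump_def[abs_def] bump_gradient_def[abs_def] by (intro continuous_intros)+

lemma bump_outside:
  assumes "0 < R" "x \<notin> cball c R"
  shows "bump c R x = 0" "bump_gradient c R x = 0"
proof -
  have "R\<^sup>2 \<le> (x - c) \<bullet> (x - c)"
    using assms by (auto simp: dot_square_norm dist_norm norm_minus_commute intro!: power_mono)
  then show "bump c R x = 0" "bump_gradient c R x = 0"
    by (simp_all add: bump_def bump_gradient_def)
qed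

lemma bump_pos:
  assumes "x \<in> ball c R"
  shows "0 < bump c R x"
proof -
  have "(x - c) \<bullet> (x - c) < R\<^sup>2"
    using assms
    by (auto simp: dot_square_norm dist_norm norm_minus_commute intro!: power_strict_mono)
  then show ?thesis
    by (simp add: bump_def)
qed

lemma locally_integrable_on_continuous:
  assumes "continuous_on UNIV f"
  shows "locally_integrable_on f \<Omega>"
  unfolding locally_integrable_on_def set_integrable_def
proof (intro allI impI)
  fix K assume "compact K \<and> K \<subseteq> \<Omega>"
  then have "integrable lborel (\<lambda>x. indicator K x *\<^sub>R f x)"
    using assms by (intro borel_integrable_compact) (auto intro: continuous_on_subset)
  then show "integrable lebesgue (\<lambda>x. indicator K x *\<^sub>R f x)"
    by (subst integrable_completion) auto
qed

lemma Lp_space_continuous_support_cball: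
  fixes f :: "'a::euclidean_space \<Rightarrow> 'b::euclidean_space"
  assumes "0 < p" "\<Omega> \<in> sets lebesgue"
    and f: "continuous_on UNIV f" "\<And>x. x \<notin> cball c R \<Longrightarrow> f x = 0"
  shows "f \<in> Lp_space (ennreal p) \<Omega>"
proof -
  have meas: "f \<in> borel_measurable borel"
    using f by (intro borel_measurable_continuous_onI)
  have "f \<in> borel_measurable (lebesgue_on \<Omega>)"
    using meas by (intro measurable_restrict_space1 measurable_completion) simp
  moreover have "(\<integral>\<^sup>+x. ennreal (norm (f x) powr p) \<partial>lebesgue_on \<Omega>) < \<infinity>"
  proof -
    obtain B where B: "0 < B" "\<And>x. norm (f x) \<le> B"
      using bounded_continuous_support_cball[OF f] by blast
    have "(\<integral>\<^sup>+x. ennreal (norm (f x) powr p) \<partial>lebesgue_on \<Omega>)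
        \<le> (\<integral>\<^sup>+x. ennreal (norm (f x) powr p) \<partial>lebesgue)"
      using assms by (subst nn_integral_restrict_space)
        (auto intro!: nn_integral_mono split: split_indicator)
    also have "\<dots> \<le> (\<integral>\<^sup>+x. ennreal (B powr p) * indicator (cball c R) x \<partial>lebesgue)"
      using assms B f(2) by (intro nn_integral_mono)
        (auto intro!: ennreal_leI powr_mono2 split: split_indicator)
    also have "\<dots> = ennreal (B powr p) * emeasure lebesgue (cball c R)"
      by (intro nn_integral_cmult_indicator) simp
    also have "\<dots> < \<infinity>"
      using emeasure_lborel_cball_finite[of c R] by (simp add: ennreal_mult_less_top less_top)
    finally show ?thesis .
  qed
  ultimately show ?thesis
    using assms by (simp add: Lp_space_def Lp_norm_def ennpowr_def)
qed

lemma lebesgue_on_integral_eq_lborel: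
  fixes f :: "'a::euclidean_space \<Rightarrow> real"
  assumes "\<Omega> \<in> sets lebesgue" "f \<in> borel_measurable borel" "\<And>x. x \<notin> \<Omega> \<Longrightarrow> f x = 0"
  shows "(LINT x|lebesgue_on \<Omega>. f x) = (LINT x|lborel. f x)"
proof -
  have "(LINT x|lebesgue_on \<Omega>. f x) = (LINT x|lebesgue. indicator \<Omega> x *\<^sub>R f x)"
    using assms by (intro integral_restrict_space) simp
  also have "\<dots> = (LINT x|lebesgue. f x)"
    using assms(3) by (intro Bochner_Integration.integral_cong) (auto simp: indicator_def)
  also have "\<dots> = (LINT x|lborel. f x)"
    using assms by (intro integral_completion) simp
  finally show ?thesis .
qed

text \<open>The product of the bump with a test function is continuously differentiable and vanishes
  outside the ball, so its partial derivatives integrate to zero. The product rule then is the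
  integration by parts formula.\<close>

lemma has_weak_gradient_bump:
  fixes \<Omega> :: "'a::euclidean_space set"
  assumes "open \<Omega>" "0 < R" "cball c R \<subseteq> \<Omega>"
  shows "has_weak_gradient \<Omega> (bump c R) (bump_gradient c R)"
  unfolding has_weak_gradient_def
proof (intro conjI ballI locally_integrable_on_continuous continuous_on_bump)
  fix \<phi> and i :: 'a
  assume \<phi>: "\<phi> \<in> test_functions \<Omega>" and i: "i \<in> Basis"
  then have "Ck (Suc 0) \<phi>"
    unfolding test_functions_def by blast
  then have diff: "\<And>x. \<phi> differentiable (at x)"
    and cont: "continuous_on UNIV (\<lambda>x. frechet_derivative \<phi> (at x) i)"
    using i by auto
  have der: "\<And>x. (\<phi> has_derivative frechet_derivative \<phi> (at x)) (at x)"
    using diff frechet_derivative_works by blast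
  have cont': "continuous_on UNIV \<phi>"
    using diff by (meson continuous_at_imp_continuous_on differentiable_imp_continuous_within)
  let ?F = "\<lambda>x. bump c R x * frechet_derivative \<phi> (at x) i"
  let ?G = "\<lambda>x. (bump_gradient c R x \<bullet> i) * \<phi> x"
  note out = bump_outside[OF \<open>0 < R\<close>, of _ c]
  have FG: "continuous_on UNIV ?F" "continuous_on UNIV ?G"
    by (intro continuous_intros continuous_on_bump cont cont')+
  have "((\<lambda>x. bump c R x * \<phi> x) has_derivative
      (\<lambda>v. bump c R x * frechet_derivative \<phi> (at x) v + (bump_gradient c R x \<bullet> v) * \<phi> x)) (at x)"
    for x
    by (rule has_derivative_mult[OF has_derivative_bump der])
  then have "(LINT x|lborel. ?F x + ?G x) = 0"
    by (rule lborel_integral_derivative_eq_0[where c = c and R = R])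
      (use FG out in \<open>auto intro!: continuous_intros\<close>)
  moreover have "integrable lborel ?F" "integrable lborel ?G"
    using FG out by (auto intro!: integrable_lborel_continuous_support_cball[where c = c and R = R])
  ultimately have "(LINT x|lborel. ?F x) = - (LINT x|lborel. ?G x)"
    by (simp add: eq_neg_iff_add_eq_0)
  \<comment> \<open>The ball lies inside \<Omega>, so both integrands vanish off \<Omega> and the
    domain of integration may be exchanged.\<close>
  moreover have "bump c R x = 0" "bump_gradient c R x = 0" if "x \<notin> \<Omega>" for x
    using that out[of x] assms(3) by blast+
  then have "(LINT x|lebesgue_on \<Omega>. ?F x) = (LINT x|lborel. ?F x)"
    "(LINT x|lebesgue_on \<Omega>. ?G x) = (LINT x|lborel. ?G x)"
    using FG assms(1)
    by (auto intro!: lebesgue_on_integral_eq_lborel borel_measurable_continuous_onI)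
  ultimately show "(LINT x|lebesgue_on \<Omega>. ?F x) = - (LINT x|lebesgue_on \<Omega>. ?G x)"
    by simp
qed

text \<open>Keeps the infima over nonzero Sobolev functions from being empty, and thereby the
  Sobolev constant from being infinite. The witness is a bump on a closed ball inside
  \<Omega>.\<close>

lemma sobolev_space_nonzero:
  fixes \<Omega> :: "'a::euclidean_space set"
  assumes "0 < p" "open \<Omega>" "\<Omega> \<noteq> {}"
  shows "\<exists>u\<in>sobolev_space p \<Omega>. \<not> ae_zero \<Omega> u"
proof -
  obtain c R where R: "0 < R" "cball c R \<subseteq> \<Omega>"
    using assms by (metis all_not_in_conv open_contains_cball)
  have \<Omega>: "\<Omega> \<in> sets lebesgue"
    using assms by simp
  have "bump c R \<in> Lp_space (ennreal p) \<Omega>" "bump_gradient c R \<in> Lp_space (ennreal p) \<Omega>"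
    by (rule Lp_space_continuous_support_cball[OF assms(1) \<Omega> continuous_on_bump(1)
          bump_outside(1)[OF R(1)]],
        assumption,
        rule Lp_space_continuous_support_cball[OF assms(1) \<Omega> continuous_on_bump(2)
          bump_outside(2)[OF R(1)]])
  then have "bump c R \<in> sobolev_space p \<Omega>"
    using has_weak_gradient_bump[OF assms(2) R] by (auto simp: sobolev_space_def)
  moreover have "\<not> ae_zero \<Omega> (bump c R)"
  proof
    assume "ae_zero \<Omega> (bump c R)"
    then have "AE x in lebesgue. x \<in> \<Omega> \<longrightarrow> bump c R x = 0"
      using \<Omega> by (simp add: ae_zero_def AE_restrict_space_iff)
    then have "AE x in lebesgue. x \<notin> ball c R"
      by eventually_elim (use R bump_pos[of _ c R] in force)
    then have "negligible (ball c R)"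
      by (simp add: AE_iff_null_sets negligible_iff_null_sets)
    then show False
      using R open_not_negligible[of "ball c R"] by simp
  qed
  ultimately show ?thesis
    by blast
qed

subsection \<open>Norms and energies as real numbers\<close>

text \<open>Only \<open>a\<close> is assumed to have a finite integral; that of \<open>b\<close> may
  be infinite, and then the value is -\<infinity>. The proof therefore integrates the
  subtraction-free identity "positive part of \<open>a - b\<close> plus \<open>b\<close> equals
  \<open>a\<close> plus negative part" and subtracts only where the terms are finite.\<close>

lemma ext_integral_diff:
  assumes [measurable]: "a \<in> borel_measurable M" "b \<in> borel_measurable M"
    and nonneg: "\<And>x. x \<in> space M \<Longrightarrow> 0 \<le> a x" "\<And>x. x \<in> space M \<Longrightarrow> 0 \<le> b x"
    and G: "(\<integral>\<^sup>+x. ennreal (a x) \<partial>M) = ennreal G" "0 \<le> G"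
  shows "ext_integral M (\<lambda>x. a x - b x) = ereal G - enn2ereal (\<integral>\<^sup>+x. ennreal (b x) \<partial>M)"
proof -
  let ?P = "\<integral>\<^sup>+x. ennreal (a x - b x) \<partial>M" and ?N = "\<integral>\<^sup>+x. ennreal (- (a x - b x)) \<partial>M"
    and ?V = "\<integral>\<^sup>+x. ennreal (b x) \<partial>M"
  have "?P + ?V = (\<integral>\<^sup>+x. ennreal (a x - b x) + ennreal (b x) \<partial>M)"
    by (simp add: nn_integral_add)
  also have "\<dots> = (\<integral>\<^sup>+x. ennreal (a x) + ennreal (- (a x - b x)) \<partial>M)"
  proof (rule nn_integral_cong)
    fix x assume "x \<in> space M"
    then show "ennreal (a x - b x) + ennreal (b x) = ennreal (a x) + ennreal (- (a x - b x))"
      using nonneg[of x] by (cases "b x \<le> a x") (simp_all add: ennreal_neg flip: ennreal_plus)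
  qed
  also have "\<dots> = ennreal G + ?N"
    by (simp add: nn_integral_add G)
  finally have eq: "?P + ?V = ennreal G + ?N" .
  \<comment> \<open>The positive part is dominated by \<open>a\<close>, so it stays finite and an
    infinite integral of \<open>b\<close> must show up in the negative part.\<close>
  have "?P \<le> ennreal G"
    unfolding G(1)[symmetric] using nonneg(2) by (intro nn_integral_mono ennreal_leI) auto
  then obtain P where P: "?P = ennreal P" "0 \<le> P"
    by (cases ?P) (auto simp: top_unique)
  show ?thesis
  proof (cases ?V)
    case (real V)
    then obtain N where N: "?N = ennreal N" "0 \<le> N"
      using eq P by (cases ?N) auto
    then have "P + V = G + N"
      using eq P real G by (simp flip: ennreal_plus)
    then show ?thesis
      using P N real unfolding ext_integral_def by simp
  next
    case top
    then have "ennreal G + ?N = top"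
      using eq by simp
    then have "?N = \<infinity>"
      by simp
    then show ?thesis
      using P top unfolding ext_integral_def by simp
  qed
qed

lemma ennpowr_ennreal:
  assumes "0 < x"
  shows "ennpowr (ennreal x) a = ennreal (x powr a)"
  using assms by (simp add: ennpowr_def)

lemma Lp_norm_ennreal:
  assumes "0 < p"
  shows "Lp_norm (ennreal p) \<Omega> u
    = ennpowr (\<integral>\<^sup>+x. ennreal (norm (u x) powr p) \<partial>lebesgue_on \<Omega>) (1 / p)"
  using assms by (simp add: Lp_norm_def)

lemma Lp_norm_ennreal_eq_iff:
  assumes "0 < p" "0 < N"
  shows "Lp_norm (ennreal p) \<Omega> u = ennreal N
    \<longleftrightarrow> (\<integral>\<^sup>+x. ennreal (norm (u x) powr p) \<partial>lebesgue_on \<Omega>) = ennreal (N powr p)"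
    (is "_ \<longleftrightarrow> ?I = _")
proof (cases ?I)
  case (real i)
  show ?thesis
  proof (cases "i = 0")
    case False
    then have "i powr (1 / p) = N \<longleftrightarrow> i = N powr p"
      using real assms by (auto simp: powr_powr)
    then show ?thesis
      using real assms False by (simp add: Lp_norm_ennreal ennpowr_ennreal)
  qed (use real assms in \<open>simp add: Lp_norm_ennreal ennpowr_def\<close>)
qed (use assms in \<open>simp add: Lp_norm_ennreal ennpowr_def\<close>)

lemma less_Lp_norm_ennreal:
  assumes "0 < p" "0 < b" "ennreal b < Lp_norm (ennreal p) \<Omega> u"
  shows "ennreal (b powr p) < (\<integral>\<^sup>+x. ennreal (norm (u x) powr p) \<partial>lebesgue_on \<Omega>)" (is "_ < ?I")
proof (cases ?I)
  case (real i)
  have "i \<noteq> 0"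
    using real assms by (auto simp: Lp_norm_ennreal ennpowr_def)
  then have "b < i powr (1 / p)"
    using real assms by (simp add: Lp_norm_ennreal ennpowr_ennreal ennreal_less_iff)
  then have "b powr p < (i powr (1 / p)) powr p"
    using assms by (intro powr_less_mono2) auto
  then show ?thesis
    using assms real by (simp add: powr_powr ennreal_less_iff)
qed simp

lemma nn_integral_powr_eq_0:
  assumes "u \<in> borel_measurable (lebesgue_on \<Omega>)"
    "(\<integral>\<^sup>+x. ennreal (\<bar>u x\<bar> powr p) \<partial>lebesgue_on \<Omega>) = 0"
  shows "ae_zero \<Omega> u"
proof -
  have "AE x in lebesgue_on \<Omega>. ennreal (\<bar>u x\<bar> powr p) = 0"
    using assms by (subst (asm) nn_integral_0_iff_AE) auto
  then show ?thesis
    unfolding ae_zero_def by eventually_elim simp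
qed

text \<open>Keeps the denominator of the Sobolev quotient away from zero, for
  \<open>r = \<infinity>\<close> as well.\<close>

lemma Lp_norm_eq_0:
  assumes "u \<in> borel_measurable (lebesgue_on \<Omega>)" "0 < r" "Lp_norm r \<Omega> u = 0"
  shows "ae_zero \<Omega> u"
proof (cases r)
  case (real \<rho>)
  then have "0 < \<rho>"
    using assms by auto
  then have "(\<integral>\<^sup>+x. ennreal (\<bar>u x\<bar> powr \<rho>) \<partial>lebesgue_on \<Omega>) = 0"
    using assms real
    by (cases "\<integral>\<^sup>+x. ennreal (\<bar>u x\<bar> powr \<rho>) \<partial>lebesgue_on \<Omega>")
      (auto simp: Lp_norm_ennreal ennpowr_def split: if_splits)
  then show ?thesis
    using assms nn_integral_powr_eq_0 by blast
next
  case top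
  then have "esssup (lebesgue_on \<Omega>) (\<lambda>x. ennreal \<bar>u x\<bar>) = 0"
    using assms by (simp add: Lp_norm_def)
  then have "AE x in lebesgue_on \<Omega>. ennreal \<bar>u x\<bar> \<le> 0"
    using esssup_AE[where M = "lebesgue_on \<Omega>" and f = "\<lambda>x. ennreal \<bar>u x\<bar>"] by simp
  then show ?thesis
    unfolding ae_zero_def by eventually_elim simp
qed

text \<open>Passes from extended norms to real numbers. As \<open>u\<close> is not almost everywhere
  zero, \<open>D\<close> is positive, so the exceptional values of \<open>ennpowr\<close> at 0 and
  \<infinity> do not occur.\<close>

lemma sobolev_space_integrals:
  assumes "0 < p" "u \<in> sobolev_space p \<Omega>" "\<not> ae_zero \<Omega> u"
  obtains G D where "0 \<le> G" "0 < D"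
    "u \<in> borel_measurable (lebesgue_on \<Omega>)"
    "weak_gradient p \<Omega> u \<in> borel_measurable (lebesgue_on \<Omega>)"
    "(\<integral>\<^sup>+x. ennreal (norm (weak_gradient p \<Omega> u x) powr p) \<partial>lebesgue_on \<Omega>) = ennreal G"
    "(\<integral>\<^sup>+x. ennreal (\<bar>u x\<bar> powr p) \<partial>lebesgue_on \<Omega>) = ennreal D"
    "sobolev_norm p \<Omega> u = ennreal ((G + D) powr (1 / p))"
    "Lp_norm (ennreal p) \<Omega> u = ennreal (D powr (1 / p))"
proof -
  let ?g = "weak_gradient p \<Omega> u"
  let ?I = "\<lambda>f. \<integral>\<^sup>+x. ennreal (norm (f x) powr p) \<partial>lebesgue_on \<Omega>"
  have fin: "\<exists>i\<ge>0. ?I f = ennreal i" if "f \<in> Lp_space (ennreal p) \<Omega>" for f :: "'a \<Rightarrow> 'b::euclidean_space"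
    using that assms(1)
    by (cases "?I f") (auto simp: Lp_space_def Lp_norm_ennreal ennpowr_def)
  have u: "u \<in> Lp_space (ennreal p) \<Omega>"
    using assms by (auto simp: sobolev_space_def)
  have "\<exists>g. has_weak_gradient \<Omega> u g \<and> g \<in> Lp_space (ennreal p) \<Omega>"
    using assms by (auto simp: sobolev_space_def)
  then have g: "?g \<in> Lp_space (ennreal p) \<Omega>"
    unfolding weak_gradient_def by (rule someI2_ex) auto
  have [measurable]: "u \<in> borel_measurable (lebesgue_on \<Omega>)" "?g \<in> borel_measurable (lebesgue_on \<Omega>)"
    using u g by (auto simp: Lp_space_def)
  obtain G where G: "0 \<le> G" "?I ?g = ennreal G"
    using g fin by blast
  obtain D where "0 \<le> D" and D: "(\<integral>\<^sup>+x. ennreal (\<bar>u x\<bar> powr p) \<partial>lebesgue_on \<Omega>) = ennreal D"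
    using u fin[of u] by auto
  have "D \<noteq> 0"
    using nn_integral_powr_eq_0[of u \<Omega> p] D assms by auto
  with \<open>0 \<le> D\<close> have "0 < D"
    by simp
  have "(\<integral>\<^sup>+x. ennreal (norm (?g x) powr p + \<bar>u x\<bar> powr p) \<partial>lebesgue_on \<Omega>) = ennreal (G + D)"
    using G D \<open>0 < D\<close> by (simp add: nn_integral_add ennreal_plus)
  then have "sobolev_norm p \<Omega> u = ennreal ((G + D) powr (1 / p))"
    using G(1) \<open>0 < D\<close> ennpowr_ennreal[of "G + D" "1 / p"] by (simp add: sobolev_norm_def)
  moreover have "Lp_norm (ennreal p) \<Omega> u = ennreal (D powr (1 / p))"
    using assms D \<open>0 < D\<close> by (simp add: Lp_norm_ennreal ennpowr_ennreal)
  ultimately show ?thesis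
    using that G D \<open>0 < D\<close> by simp
qed

section \<open>Hoelder duality for all admissible exponents, including
  \<open>r = \<infinity>\<close>\<close>

lemma Hoelder_Lp_norm:
  fixes u W :: "'a::euclidean_space \<Rightarrow> real"
  assumes meas: "u \<in> borel_measurable (lebesgue_on \<Omega>)" "W \<in> borel_measurable (lebesgue_on \<Omega>)"
    and W: "\<And>x. x \<in> \<Omega> \<Longrightarrow> 0 \<le> W x"
    and "0 < p" "1 \<le> q" "r = (if q = 1 then \<infinity> else ennreal (p * q / (q - 1)))" "0 < t" "0 < N"
    and t: "(\<integral>\<^sup>+x. ennreal (W x powr q) \<partial>lebesgue_on \<Omega>) = ennreal (t powr q)"
    and N: "Lp_norm r \<Omega> u = ennreal N"
  shows "(\<integral>\<^sup>+x. ennreal (W x * \<bar>u x\<bar> powr p) \<partial>lebesgue_on \<Omega>) \<le> ennreal (t * N powr p)"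
proof (cases "q = 1")
  case True
  have "(\<integral>\<^sup>+x. ennreal (W x) \<partial>lebesgue_on \<Omega>) = (\<integral>\<^sup>+x. ennreal (W x powr q) \<partial>lebesgue_on \<Omega>)"
    using True W by (intro nn_integral_cong) simp
  then show ?thesis
    using assms True by (intro nn_integral_le_esssup_power) (auto simp: Lp_norm_def)
next
  case False
  then show ?thesis
    using assms by (intro nn_integral_Hoelder_power[where q = q and \<rho> = "p * q / (q - 1)"])
      (auto simp: Lp_norm_ennreal_eq_iff)
qed

lemma exists_Hoelder_Lp_norm:
  fixes u :: "'a::euclidean_space \<Rightarrow> real"
  assumes u: "u \<in> borel_measurable (lebesgue_on \<Omega>)"
    and "0 < p" "1 \<le> q" "r = (if q = 1 then \<infinity> else ennreal (p * q / (q - 1)))" "0 < b"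
    and fin: "(\<integral>\<^sup>+x. ennreal (\<bar>u x\<bar> powr p) \<partial>lebesgue_on \<Omega>) < \<infinity>"
    and b: "ennreal b < Lp_norm r \<Omega> u"
  shows "\<exists>W\<in>borel_measurable (lebesgue_on \<Omega>). (\<forall>x. 0 \<le> W x) \<and>
    (\<integral>\<^sup>+x. ennreal (W x powr q) \<partial>lebesgue_on \<Omega>) = 1 \<and>
    ennreal (b powr p) \<le> (\<integral>\<^sup>+x. ennreal (W x * \<bar>u x\<bar> powr p) \<partial>lebesgue_on \<Omega>)"
proof (cases "q = 1")
  case True
  then have "ennreal b < esssup (lebesgue_on \<Omega>) (\<lambda>x. ennreal \<bar>u x\<bar>)"
    using assms by (simp add: Lp_norm_def)
  from exists_nn_integral_esssup_power[OF u assms(2,5) fin this]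
  obtain W where "W \<in> borel_measurable (lebesgue_on \<Omega>)" "\<And>x. 0 \<le> W x"
    "(\<integral>\<^sup>+x. ennreal (W x) \<partial>lebesgue_on \<Omega>) = 1"
    "ennreal (b powr p) \<le> (\<integral>\<^sup>+x. ennreal (W x * \<bar>u x\<bar> powr p) \<partial>lebesgue_on \<Omega>)"
    by blast
  with True show ?thesis
    by (intro bexI[of _ W]) simp_all
next
  case False
  then show ?thesis
    using assms less_Lp_norm_ennreal[of "p * q / (q - 1)" b \<Omega> u]
    by (intro exists_nn_integral_Hoelder_power) auto
qed

text \<open>Read as p/r = 1 - 1/q, the relation gives \<open>1 < q\<close> and the explicit
  \<open>r\<close> when \<open>r\<close> is finite, and leaves \<open>q = 1\<close> for
  \<open>r = \<infinity>\<close>. The value of 1/r is what determines \<theta>.\<close>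

lemma conjugate_exponent:
  fixes q p :: real and r :: ennreal
  assumes "0 < p" "0 < q" "ennreal p < r" "1 / ennreal q + ennreal p / r = 1"
  shows "1 \<le> q" "r = (if q = 1 then \<infinity> else ennreal (p * q / (q - 1)))"
    "enn2real (1 / r) = (1 - 1 / q) / p"
proof -
  have 1: "1 / ennreal q = ennreal (1 / q)"
    using assms divide_ennreal[of 1 q] by simp
  have "1 \<le> q \<and> r = (if q = 1 then \<infinity> else ennreal (p * q / (q - 1))) \<and>
    enn2real (1 / r) = (1 - 1 / q) / p"
  proof (cases r)
    case (real \<rho>)
    then have \<rho>: "p < \<rho>"
      using assms by (simp add: ennreal_less_iff)
    then have "ennreal p / r = ennreal (p / \<rho>)" "1 / r = ennreal (1 / \<rho>)"
      using assms real divide_ennreal[of p \<rho>] divide_ennreal[of 1 \<rho>] by simp_all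
    moreover from this have eq: "1 / q + p / \<rho> = 1"
      using assms 1 \<rho> by (simp flip: ennreal_plus)
    moreover have "0 < p / \<rho>"
      using \<rho> assms by simp
    then have "1 / q < 1"
      using eq by linarith
    then have "1 < q"
      using assms by simp
    moreover have "\<rho> = p * q / (q - 1)"
      using eq \<open>1 < q\<close> \<rho> assms(1) by (simp add: field_simps)
    moreover have "1 / \<rho> = (1 - 1 / q) / p"
      using eq \<rho> assms(1,2) by (simp add: field_simps)
    ultimately show ?thesis
      using real \<rho> assms(1) by simp
  next
    case top
    then have "ennreal (1 / q) = ennreal 1"
      using assms 1 by simp
    then have "q = 1"
      using assms by (subst (asm) ennreal_inj) auto
    then show ?thesis
      using top by simp
  qed
  then show "1 \<le> q" "r = (if q = 1 then \<infinity> else ennreal (p * q / (q - 1)))"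
    "enn2real (1 / r) = (1 - 1 / q) / p"
    by auto
qed

text \<open>The Rayleigh quotient minimised in \<open>ground_energy\<close>, isolated so that it can
  be estimated for a single pair of \<open>W\<close> and \<open>u\<close>.\<close>

definition energy_quotient ::
  "real \<Rightarrow> 'a::euclidean_space set \<Rightarrow> ('a \<Rightarrow> real) \<Rightarrow> ('a \<Rightarrow> real) \<Rightarrow> ereal" where
  "energy_quotient p \<Omega> W u =
    ext_integral (lebesgue_on \<Omega>) (\<lambda>x. norm (weak_gradient p \<Omega> u x) powr p - W x * \<bar>u x\<bar> powr p)
      / ext_integral (lebesgue_on \<Omega>) (\<lambda>x. \<bar>u x\<bar> powr p)"

lemma energy_quotient_eq:
  assumes [measurable]: "u \<in> borel_measurable (lebesgue_on \<Omega>)"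
    "weak_gradient p \<Omega> u \<in> borel_measurable (lebesgue_on \<Omega>)"
    "W \<in> borel_measurable (lebesgue_on \<Omega>)"
    and W: "\<And>x. x \<in> \<Omega> \<Longrightarrow> 0 \<le> W x" and "0 \<le> G" "0 < D"
    and G: "(\<integral>\<^sup>+x. ennreal (norm (weak_gradient p \<Omega> u x) powr p) \<partial>lebesgue_on \<Omega>) = ennreal G"
    and D: "(\<integral>\<^sup>+x. ennreal (\<bar>u x\<bar> powr p) \<partial>lebesgue_on \<Omega>) = ennreal D"
  shows "energy_quotient p \<Omega> W u
    = (ereal G - enn2ereal (\<integral>\<^sup>+x. ennreal (W x * \<bar>u x\<bar> powr p) \<partial>lebesgue_on \<Omega>)) / ereal D"
proof -
  have "ext_integral (lebesgue_on \<Omega>)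
      (\<lambda>x. norm (weak_gradient p \<Omega> u x) powr p - W x * \<bar>u x\<bar> powr p)
    = ereal G - enn2ereal (\<integral>\<^sup>+x. ennreal (W x * \<bar>u x\<bar> powr p) \<partial>lebesgue_on \<Omega>)"
    using assms by (intro ext_integral_diff) auto
  moreover have "ext_integral (lebesgue_on \<Omega>) (\<lambda>x. \<bar>u x\<bar> powr p) = ereal D"
    using D \<open>0 < D\<close> by (simp add: ext_integral_def ennreal_neg zero_ennreal.rep_eq)
  ultimately show ?thesis
    by (simp add: energy_quotient_def)
qed

text \<open>Inverts a decreasing power. The value \<open>S = 0\<close>, whose negative power is
  infinite, is included, so a vanishing Sobolev constant needs no separate case in the sharpness
  argument.\<close>

lemma ennreal_less_ennpowr_minus:
  assumes "0 < a" "0 < y" "ennreal y < ennpowr S (- a)"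
  shows "S < ennreal (y powr (- 1 / a))"
proof (cases S)
  case (real \<sigma>)
  show ?thesis
  proof (cases "\<sigma> = 0")
    case False
    then have "y < \<sigma> powr (- a)"
      using assms real by (simp add: ennpowr_ennreal ennreal_less_iff)
    then have "(\<sigma> powr (- a)) powr (- 1 / a) < y powr (- 1 / a)"
      using assms by (intro powr_less_mono2_neg) auto
    then show ?thesis
      using real assms False by (simp add: powr_powr ennreal_less_iff)
  qed (use real assms in simp)
qed (use assms in \<open>simp add: ennpowr_def\<close>)

text \<open>Identifies the minimum over \<open>t\<close> with a power of the Sobolev quotient
  \<open>K / N\<close>. The relation \<open>\<theta> * (1 + \<alpha>) = \<alpha>\<close> is exactly
  what makes \<open>K powr a\<close> equal to \<open>A powr \<alpha> * D\<close>.\<close>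

lemma keller_scaling:
  fixes \<alpha> A D p \<theta> K N a :: real
  assumes "0 < A" "0 < D" "0 < p" "0 < N"
    and K: "K = (A powr (1 / p)) powr \<theta> * (D powr (1 / p)) powr (1 - \<theta>)"
    and a: "a = p * (1 + \<alpha>)" "\<theta> * (1 + \<alpha>) = \<alpha>"
  shows "A powr - \<alpha> * (N powr p) powr (1 + \<alpha>) / D = (K / N) powr - a"
proof -
  have "1 / p * \<theta> * a = \<theta> * (1 + \<alpha>)" "1 / p * (1 - \<theta>) * a = 1 + \<alpha> - \<theta> * (1 + \<alpha>)"
    using assms(3) unfolding a(1) by (auto simp: field_simps)
  then have exps: "1 / p * \<theta> * a = \<alpha>" "1 / p * (1 - \<theta>) * a = 1"
    by (simp_all only: a(2) add_diff_cancel_right')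
  have "K powr a = A powr (1 / p * \<theta> * a) * D powr (1 / p * (1 - \<theta>) * a)"
    using assms(1,2) by (simp add: K powr_mult powr_powr)
  then have "K powr a = A powr \<alpha> * D"
    unfolding exps using assms(2) by simp
  moreover have "0 < K"
    using assms(1,2) by (simp add: K)
  then have "(K / N) powr - a = N powr a / K powr a"
    using assms(4) by (simp add: powr_minus powr_divide)
  ultimately show ?thesis
    using assms(1,2) a(1) by (simp add: powr_powr powr_minus field_simps)
qed

section \<open>The energy inequality and its sharpness for given exponents\<close>

context
  fixes \<Omega> :: "'a::euclidean_space set" and p q \<gamma> \<alpha> \<theta> :: real and r :: ennreal
  assumes p: "1 < p" and \<gamma>: "0 < \<gamma>" and q: "1 \<le> q"
    and \<alpha>: "0 < \<alpha>" "q / \<gamma> = 1 + \<alpha>" and \<theta>: "\<theta> * (1 + \<alpha>) = \<alpha>" "\<theta> = sobolev_theta DIM('a) p r"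
    and r: "0 < r" "r = (if q = 1 then \<infinity> else ennreal (p * q / (q - 1)))"
begin

text \<open>\<open>K\<close> is the numerator of the Sobolev quotient of \<open>u\<close>.
  \<open>N\<close> stays free because it will be the \<open>r\<close>-norm itself in the lower bound
  but only a real number below it in the sharpness argument; \<open>W\<close> stays free because
  there the potential is built from \<open>u\<close>.\<close>

lemma sobolev_quotient:
  assumes "u \<in> sobolev_space p \<Omega>" "\<not> ae_zero \<Omega> u"
  obtains G D K where "0 \<le> G" "0 < D" "0 < K"
    "u \<in> borel_measurable (lebesgue_on \<Omega>)"
    "(\<integral>\<^sup>+x. ennreal (\<bar>u x\<bar> powr p) \<partial>lebesgue_on \<Omega>) = ennreal D"
    "ennpowr (sobolev_norm p \<Omega> u) \<theta> * ennpowr (Lp_norm (ennreal p) \<Omega> u) (1 - \<theta>) = ennreal K"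
    "\<And>N. 0 < N \<Longrightarrow>
      (G + D) powr - \<alpha> * (N powr p) powr (1 + \<alpha>) / D = (K / N) powr - (p * (1 + \<alpha>))"
    "\<And>W. W \<in> borel_measurable (lebesgue_on \<Omega>) \<Longrightarrow> (\<And>x. x \<in> \<Omega> \<Longrightarrow> 0 \<le> W x) \<Longrightarrow>
      energy_quotient p \<Omega> W u
      = (ereal G - enn2ereal (\<integral>\<^sup>+x. ennreal (W x * \<bar>u x\<bar> powr p) \<partial>lebesgue_on \<Omega>)) / ereal D"
proof -
  have "0 < p"
    using p by simp
  from sobolev_space_integrals[OF this assms]
  obtain G D where GD: "0 \<le> G" "0 < D"
    "u \<in> borel_measurable (lebesgue_on \<Omega>)"
    "weak_gradient p \<Omega> u \<in> borel_measurable (lebesgue_on \<Omega>)"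
    "(\<integral>\<^sup>+x. ennreal (norm (weak_gradient p \<Omega> u x) powr p) \<partial>lebesgue_on \<Omega>) = ennreal G"
    "(\<integral>\<^sup>+x. ennreal (\<bar>u x\<bar> powr p) \<partial>lebesgue_on \<Omega>) = ennreal D"
    "sobolev_norm p \<Omega> u = ennreal ((G + D) powr (1 / p))"
    "Lp_norm (ennreal p) \<Omega> u = ennreal (D powr (1 / p))"
    by blast
  let ?K = "((G + D) powr (1 / p)) powr \<theta> * (D powr (1 / p)) powr (1 - \<theta>)"
  show ?thesis
  proof
    show "ennpowr (sobolev_norm p \<Omega> u) \<theta> * ennpowr (Lp_norm (ennreal p) \<Omega> u) (1 - \<theta>) = ennreal ?K"
      using GD by (simp add: ennpowr_ennreal ennreal_mult)
    show "(G + D) powr - \<alpha> * (N powr p) powr (1 + \<alpha>) / D = (?K / N) powr - (p * (1 + \<alpha>))"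
      if "0 < N" for N
      using that GD p \<theta> by (intro keller_scaling[where \<theta> = \<theta>]) auto
    show "energy_quotient p \<Omega> W u
      = (ereal G - enn2ereal (\<integral>\<^sup>+x. ennreal (W x * \<bar>u x\<bar> powr p) \<partial>lebesgue_on \<Omega>)) / ereal D"
      if "W \<in> borel_measurable (lebesgue_on \<Omega>)" "\<And>x. x \<in> \<Omega> \<Longrightarrow> 0 \<le> W x" for W
      using GD that by (intro energy_quotient_eq) auto
  qed (use GD in auto)
qed

lemma sobolev_const_eq_INF:
  "sobolev_const p r \<Omega> = (INF u\<in>{u \<in> sobolev_space p \<Omega>. \<not> ae_zero \<Omega> u}.
    ennpowr (sobolev_norm p \<Omega> u) \<theta> * ennpowr (Lp_norm (ennreal p) \<Omega> u) (1 - \<theta>) / Lp_norm r \<Omega> u)"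
  by (simp add: sobolev_const_def \<theta>(2) Let_def)

lemma sobolev_const_finite:
  assumes u: "u \<in> sobolev_space p \<Omega>" "\<not> ae_zero \<Omega> u"
  shows "sobolev_const p r \<Omega> < \<infinity>"
proof -
  obtain K where K: "u \<in> borel_measurable (lebesgue_on \<Omega>)"
    "ennpowr (sobolev_norm p \<Omega> u) \<theta> * ennpowr (Lp_norm (ennreal p) \<Omega> u) (1 - \<theta>) = ennreal K"
    by (rule sobolev_quotient[OF u]) blast
  have "sobolev_const p r \<Omega> \<le> ennreal K / Lp_norm r \<Omega> u"
    unfolding sobolev_const_eq_INF K(2)[symmetric] using u by (intro INF_lower) auto
  also have "\<dots> < \<infinity>"
    using Lp_norm_eq_0[OF K(1) r(1)] u by (auto simp: less_top[symmetric] ennreal_divide_eq_top_iff)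
  finally show ?thesis .
qed

lemma powr_inverse_exponent:
  assumes "0 < t"
  shows "(t powr q) powr (1 / \<gamma>) = t powr (1 + \<alpha>)"
  using \<alpha>(2) by (simp add: powr_powr)

text \<open>Hoelder's inequality replaces the potential term by \<open>t * N powr p\<close>,
  \<open>keller_lower_bound\<close> applies with \<open>A = G + D\<close>, and the Sobolev constant
  bounds the resulting power of \<open>K / N\<close>.\<close>

lemma keller_inequality_le:
  assumes "sobolev_const p r \<Omega> = ennreal \<sigma>" "0 < \<sigma>"
    and W: "W \<in> borel_measurable (lebesgue_on \<Omega>)" "\<And>x. x \<in> \<Omega> \<Longrightarrow> 0 \<le> W x"
    and t: "0 < t" "(\<integral>\<^sup>+x. ennreal (W x powr q) \<partial>lebesgue_on \<Omega>) = ennreal (t powr q)"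
    and u: "u \<in> sobolev_space p \<Omega>" "\<not> ae_zero \<Omega> u"
  shows "ereal (- keller_factor \<alpha> * \<sigma> powr - (p * (1 + \<alpha>)) * t powr (1 + \<alpha>) - 1)
    \<le> energy_quotient p \<Omega> W u"
proof -
  obtain G D K where GDK: "0 \<le> G" "0 < D" "0 < K"
    "u \<in> borel_measurable (lebesgue_on \<Omega>)"
    "ennpowr (sobolev_norm p \<Omega> u) \<theta> * ennpowr (Lp_norm (ennreal p) \<Omega> u) (1 - \<theta>) = ennreal K"
    "\<And>N. 0 < N \<Longrightarrow>
      (G + D) powr - \<alpha> * (N powr p) powr (1 + \<alpha>) / D = (K / N) powr - (p * (1 + \<alpha>))"
    and E: "energy_quotient p \<Omega> W u
      = (ereal G - enn2ereal (\<integral>\<^sup>+x. ennreal (W x * \<bar>u x\<bar> powr p) \<partial>lebesgue_on \<Omega>)) / ereal D"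
    by (rule sobolev_quotient[OF u]) (use W in blast)
  have \<sigma>le: "ennreal \<sigma> \<le> ennreal K / Lp_norm r \<Omega> u"
    unfolding assms(1)[symmetric] sobolev_const_eq_INF GDK(5)[symmetric]
    using u by (intro INF_lower) auto
  \<comment> \<open>An infinite denominator would make the quotient 0, below the positive constant
    \<sigma>.\<close>
  then have "Lp_norm r \<Omega> u \<noteq> \<infinity>"
    using \<open>0 < \<sigma>\<close> by (auto simp: ennreal_divide_top)
  moreover have "Lp_norm r \<Omega> u \<noteq> 0"
    using Lp_norm_eq_0[OF GDK(4) r(1)] u by auto
  ultimately obtain N where N: "Lp_norm r \<Omega> u = ennreal N" "0 < N"
    by (cases "Lp_norm r \<Omega> u") auto
  have \<sigma>K: "\<sigma> \<le> K / N"
    using \<sigma>le N GDK(3) \<open>0 < \<sigma>\<close> by (simp add: divide_ennreal)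
  have "(\<integral>\<^sup>+x. ennreal (W x * \<bar>u x\<bar> powr p) \<partial>lebesgue_on \<Omega>) \<le> ennreal (t * N powr p)"
    using GDK(4) W p q r t N by (intro Hoelder_Lp_norm) auto
  then obtain v where v: "(\<integral>\<^sup>+x. ennreal (W x * \<bar>u x\<bar> powr p) \<partial>lebesgue_on \<Omega>) = ennreal v"
    "0 \<le> v" "v \<le> t * N powr p"
    using t N by (cases "\<integral>\<^sup>+x. ennreal (W x * \<bar>u x\<bar> powr p) \<partial>lebesgue_on \<Omega>") (auto simp: top_unique)
  let ?s = "t powr (1 + \<alpha>)"
  have "- (keller_factor \<alpha> * (K / N) powr - (p * (1 + \<alpha>)))
      = - (keller_factor \<alpha> * ((G + D) powr - \<alpha> * (N powr p) powr (1 + \<alpha>))) / D"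
    unfolding GDK(6)[OF N(2), symmetric] by simp
  also have "\<dots> \<le> ((G + D) - t * N powr p) / ?s / D"
    using keller_lower_bound[of \<alpha> "G + D" "N powr p" t] \<alpha> GDK N t
    by (intro divide_right_mono) auto
  also have "\<dots> \<le> ((G + D) - v) / ?s / D"
    using v GDK by (intro divide_right_mono) auto
  finally have "- (keller_factor \<alpha> * (K / N) powr - (p * (1 + \<alpha>))) \<le> ((G + D) - v) / ?s / D" .
  moreover have "(K / N) powr - (p * (1 + \<alpha>)) \<le> \<sigma> powr - (p * (1 + \<alpha>))"
    using \<sigma>K \<open>0 < \<sigma>\<close> p \<alpha> by (intro powr_mono2') auto
  then have "keller_factor \<alpha> * (K / N) powr - (p * (1 + \<alpha>))
      \<le> keller_factor \<alpha> * \<sigma> powr - (p * (1 + \<alpha>))"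
    by (intro mult_left_mono) auto
  ultimately have "- (keller_factor \<alpha> * \<sigma> powr - (p * (1 + \<alpha>))) \<le> ((G + D) - v) / D / ?s"
    by (simp add: mult.commute)
  then have "- (keller_factor \<alpha> * \<sigma> powr - (p * (1 + \<alpha>))) * ?s \<le> ((G + D) - v) / D"
    using t by (simp only: pos_le_divide_eq powr_gt_zero)
  \<comment> \<open>The summand 1 is the share of \<open>D\<close> in \<open>A = G + D\<close>; it
    is the source of the 1 added to the ground energy.\<close>
  also have "\<dots> = (G - v) / D + 1"
    using GDK by (simp add: field_simps)
  finally have "- keller_factor \<alpha> * \<sigma> powr - (p * (1 + \<alpha>)) * ?s - 1 \<le> (G - v) / D"
    by simp
  then show ?thesis
    using v GDK unfolding E by simp
qed

text \<open>Neither the Sobolev infimum nor Hoelder's bound need be attained, so both are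
  approximated: \<open>y\<close> stands for any positive real below the power of the Sobolev
  constant.\<close>

lemma keller_inequality_sharp:
  assumes y: "0 < y" "ennreal y < ennpowr (sobolev_const p r \<Omega>) (- (p * (1 + \<alpha>)))"
  obtains u W t where "u \<in> sobolev_space p \<Omega>" "\<not> ae_zero \<Omega> u"
    "W \<in> borel_measurable (lebesgue_on \<Omega>)" "\<And>x. 0 \<le> W x" "0 < t"
    "(\<integral>\<^sup>+x. ennreal (W x powr q) \<partial>lebesgue_on \<Omega>) = ennreal (t powr q)"
    "energy_quotient p \<Omega> W u \<le> ereal (- keller_factor \<alpha> * y * t powr (1 + \<alpha>) - 1)"
proof -
  have apos: "0 < p * (1 + \<alpha>)"
    using p \<alpha> by simp
  \<comment> \<open>Chosen so that \<open>\<sigma> powr - (p * (1 + \<alpha>)) = y\<close>; some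
    \<open>u\<close> then has Sobolev quotient below \<sigma>.\<close>
  define \<sigma> where "\<sigma> = y powr (- 1 / (p * (1 + \<alpha>)))"
  have \<sigma>: "0 < \<sigma>" "\<sigma> powr - (p * (1 + \<alpha>)) = y"
    using y(1) apos unfolding \<sigma>_def powr_powr by auto
  have "sobolev_const p r \<Omega> < ennreal \<sigma>"
    unfolding \<sigma>_def using y apos by (intro ennreal_less_ennpowr_minus) auto
  then obtain u where u: "u \<in> sobolev_space p \<Omega>" "\<not> ae_zero \<Omega> u"
    and lt: "ennpowr (sobolev_norm p \<Omega> u) \<theta> * ennpowr (Lp_norm (ennreal p) \<Omega> u) (1 - \<theta>)
      / Lp_norm r \<Omega> u < ennreal \<sigma>"
    unfolding sobolev_const_eq_INF INF_less_iff by auto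
  obtain G D K where GDK: "0 \<le> G" "0 < D" "0 < K"
    "u \<in> borel_measurable (lebesgue_on \<Omega>)"
    "(\<integral>\<^sup>+x. ennreal (\<bar>u x\<bar> powr p) \<partial>lebesgue_on \<Omega>) = ennreal D"
    "ennpowr (sobolev_norm p \<Omega> u) \<theta> * ennpowr (Lp_norm (ennreal p) \<Omega> u) (1 - \<theta>) = ennreal K"
    "\<And>N. 0 < N \<Longrightarrow>
      (G + D) powr - \<alpha> * (N powr p) powr (1 + \<alpha>) / D = (K / N) powr - (p * (1 + \<alpha>))"
    and E: "\<And>W. W \<in> borel_measurable (lebesgue_on \<Omega>) \<Longrightarrow> (\<And>x. x \<in> \<Omega> \<Longrightarrow> 0 \<le> W x) \<Longrightarrow>
      energy_quotient p \<Omega> W u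
      = (ereal G - enn2ereal (\<integral>\<^sup>+x. ennreal (W x * \<bar>u x\<bar> powr p) \<partial>lebesgue_on \<Omega>)) / ereal D"
    by (rule sobolev_quotient[OF u]) blast
  \<comment> \<open>Solved for the \<open>r\<close>-norm, the strict inequality also covers an
    infinite norm and leaves room for a real \<open>b\<close> in between.\<close>
  have "ennreal (K / \<sigma>) < Lp_norm r \<Omega> u"
  proof (cases "Lp_norm r \<Omega> u")
    case (real N)
    have "Lp_norm r \<Omega> u \<noteq> 0"
      using Lp_norm_eq_0[OF GDK(4) r(1)] u by auto
    then have "0 < N"
      using real by (cases "N = 0") auto
    then have "K / N < \<sigma>"
      using lt real GDK \<sigma> by (simp add: divide_ennreal ennreal_less_iff)
    then show ?thesis
      using real \<open>0 < N\<close> \<sigma> GDK by (simp add: ennreal_less_iff field_simps)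
  qed simp
  then obtain b' where b': "ennreal (K / \<sigma>) < b'" "b' < Lp_norm r \<Omega> u"
    using dense by blast
  then obtain b where b: "K / \<sigma> < b" "ennreal b < Lp_norm r \<Omega> u"
    using GDK \<sigma> by (cases b') (auto simp: ennreal_less_iff)
  have "0 < K / \<sigma>"
    using GDK \<sigma> by simp
  then have bpos: "0 < b"
    using b by linarith
  obtain W where W[measurable]: "W \<in> borel_measurable (lebesgue_on \<Omega>)" and W0: "\<And>x. 0 \<le> W x"
    and W1: "(\<integral>\<^sup>+x. ennreal (W x powr q) \<partial>lebesgue_on \<Omega>) = 1"
    and Wb: "ennreal (b powr p) \<le> (\<integral>\<^sup>+x. ennreal (W x * \<bar>u x\<bar> powr p) \<partial>lebesgue_on \<Omega>)"
    using exists_Hoelder_Lp_norm[OF GDK(4) _ q r(2) bpos _ b(2)] p GDK(5) by auto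
  \<comment> \<open>The critical point of \<open>keller_optimum\<close> for \<open>A = G + D\<close>
    and \<open>B = b powr p\<close>. Since \<open>W\<close> is normalised, \<open>t * W\<close> is a
    potential of norm \<open>t\<close>.\<close>
  define t where "t = (1 + \<alpha>) * (G + D) / (\<alpha> * b powr p)"
  have t: "0 < t"
    using \<alpha> GDK bpos by (auto simp: t_def)
  have [measurable]: "u \<in> borel_measurable (lebesgue_on \<Omega>)"
    by (rule GDK)
  let ?s = "t powr (1 + \<alpha>)" and ?V = "\<integral>\<^sup>+x. ennreal (t * W x * \<bar>u x\<bar> powr p) \<partial>lebesgue_on \<Omega>"
  have "ennreal (t * b powr p) = ennreal t * ennreal (b powr p)"
    using t by (simp add: ennreal_mult)
  also have "\<dots> \<le> ennreal t * (\<integral>\<^sup>+x. ennreal (W x * \<bar>u x\<bar> powr p) \<partial>lebesgue_on \<Omega>)"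
    by (intro mult_left_mono Wb) simp
  also have "\<dots> = ?V"
    using t W0 by (simp add: ennreal_mult mult.assoc flip: nn_integral_cmult)
  finally have V: "ennreal (t * b powr p) \<le> ?V" .
  have "((G + D) - t * b powr p) / ?s
      = - (keller_factor \<alpha> * ((G + D) powr - \<alpha> * (b powr p) powr (1 + \<alpha>)))"
    unfolding t_def using \<alpha> GDK bpos by (intro keller_optimum) auto
  then have "((G + D) - t * b powr p) / ?s / D
      = - (keller_factor \<alpha> * (K / b) powr - (p * (1 + \<alpha>)))"
    unfolding GDK(7)[OF bpos, symmetric] by simp
  moreover have "K / b \<le> \<sigma>"
    using b bpos \<sigma> by (simp add: field_simps)
  then have "y \<le> (K / b) powr - (p * (1 + \<alpha>))"
    unfolding \<sigma>(2)[symmetric] using GDK bpos apos by (intro powr_mono2') auto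
  then have "keller_factor \<alpha> * y \<le> keller_factor \<alpha> * (K / b) powr - (p * (1 + \<alpha>))"
    by (intro mult_left_mono) auto
  ultimately have "((G + D) - t * b powr p) / D / ?s \<le> - (keller_factor \<alpha> * y)"
    by (simp add: mult.commute)
  then have "((G + D) - t * b powr p) / D \<le> - (keller_factor \<alpha> * y) * ?s"
    using t by (simp only: pos_divide_le_eq powr_gt_zero)
  moreover have "((G + D) - t * b powr p) / D = (G - t * b powr p) / D + 1"
    using GDK by (simp add: field_simps)
  ultimately have *: "(G - t * b powr p) / D \<le> - keller_factor \<alpha> * y * ?s - 1"
    by simp
  \<comment> \<open>The potential term of \<open>t * W\<close> may be infinite, so the comparison
    takes place in the extended reals.\<close>
  have "enn2ereal (ennreal (t * b powr p)) \<le> enn2ereal ?V"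
    using V by (simp add: less_eq_ennreal.rep_eq)
  then have "ereal (t * b powr p) \<le> enn2ereal ?V"
    using t by simp
  then have "(ereal G - enn2ereal ?V) / ereal D \<le> (ereal G - ereal (t * b powr p)) / ereal D"
    using GDK by (intro ereal_divide_right_mono ereal_minus_mono) auto
  also have "\<dots> \<le> ereal (- keller_factor \<alpha> * y * ?s - 1)"
    using * GDK by simp
  finally have le: "(ereal G - enn2ereal ?V) / ereal D \<le> ereal (- keller_factor \<alpha> * y * ?s - 1)" .
  have "(\<integral>\<^sup>+x. ennreal ((t * W x) powr q) \<partial>lebesgue_on \<Omega>)
      = ennreal (t powr q) * (\<integral>\<^sup>+x. ennreal (W x powr q) \<partial>lebesgue_on \<Omega>)"
    using t W0 by (simp add: powr_mult ennreal_mult flip: nn_integral_cmult)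
  then show ?thesis
    using that[of u "\<lambda>x. t * W x" t] u t W0 W1 le E[of "\<lambda>x. t * W x"] by simp
qed

end

section \<open>Passage to the infima over Sobolev functions and potentials\<close>

theorem theorem8:
  fixes \<Omega> :: "'a::euclidean_space set" and p \<gamma> :: real and r :: ennreal
  assumes "1 < p"
    and "extension_domain p \<Omega>"
    and "p \<le> DIM('a) \<Longrightarrow> 0 < \<gamma>"
    and "DIM('a) < p \<Longrightarrow> 1 - DIM('a) / p \<le> \<gamma>"
    and "ennreal p < r"
    and "1 / ennreal (\<gamma> + DIM('a) / p) + ennreal p / r = 1"
  shows "(INF W\<in>{W \<in> Lp_space (ennreal (\<gamma> + DIM('a) / p)) \<Omega>. (\<forall>x\<in>\<Omega>. 0 \<le> W x) \<and> \<not> ae_zero \<Omega> W}.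
            (ground_energy p \<Omega> W + 1)
              / ereal ((LINT x|lebesgue_on \<Omega>. W x powr (\<gamma> + DIM('a) / p)) powr (1 / \<gamma>)))
         = - ereal (keller_const DIM('a) p \<gamma>)
             * enn2ereal (ennpowr (sobolev_const p r \<Omega>) (- (p * (\<gamma> + DIM('a) / p) / \<gamma>)))"
proof -
  define q where "q = \<gamma> + DIM('a) / p"
  define \<alpha> where "\<alpha> = DIM('a) / (p * \<gamma>)"
  define \<theta> where "\<theta> = sobolev_theta DIM('a) p r"
  define c where "c = keller_factor \<alpha>"
  define S where "S = sobolev_const p r \<Omega>"
  let ?a = "p * (1 + \<alpha>)"
  let ?U = "{u \<in> sobolev_space p \<Omega>. \<not> ae_zero \<Omega> u}"
  have \<gamma>: "0 < \<gamma>"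
  proof (cases "p \<le> DIM('a)")
    case False
    then have "0 < 1 - DIM('a) / p" "DIM('a) < p"
      using assms(1) by simp_all
    with assms(4) show ?thesis
      by linarith
  qed (use assms(3) in simp)
  have p: "0 < p" "1 < p"
    using assms(1) by auto
  have qpos: "0 < q"
    using \<gamma> p by (simp add: q_def add_pos_nonneg)
  note q = conjugate_exponent[OF p(1) qpos assms(5) assms(6)[folded q_def]]
  have \<alpha>: "0 < \<alpha>" "q / \<gamma> = 1 + \<alpha>"
    using \<gamma> p by (auto simp: \<alpha>_def q_def field_simps)
  \<comment> \<open>Insert 1/r = (1 - 1/q)/p into the formula for \<theta>; multiplication by
    \<open>1 + \<alpha> = q / \<gamma>\<close> then gives n/(p\<gamma>).\<close>
  have "\<theta> = DIM('a) / (p * q)"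
    using p qpos by (simp add: \<theta>_def sobolev_theta_def q(3) field_simps)
  also have "\<dots> * (1 + \<alpha>) = \<alpha>"
    using \<alpha>(2)[symmetric] qpos p \<gamma> by (simp add: \<alpha>_def)
  finally have \<theta>: "\<theta> * (1 + \<alpha>) = \<alpha>" .
  have a: "p * (\<gamma> + DIM('a) / p) / \<gamma> = ?a"
    unfolding q_def[symmetric] \<alpha>(2)[symmetric] by simp
  have r: "0 < r"
    using assms(5) by (auto intro: le_less_trans)
  have c: "keller_const DIM('a) p \<gamma> = c" "0 < c"
    using \<alpha>(1) by (simp add: c_def keller_const_def \<alpha>_def, simp add: c_def)
  note setting = p(2) \<gamma> q(1) \<alpha> \<theta> \<theta>_def r q(2)
  have \<Omega>: "open \<Omega>" "\<Omega> \<noteq> {}"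
    using assms(2) by (auto simp: extension_domain_def domain_def)
  obtain u\<^sub>0 where u\<^sub>0: "u\<^sub>0 \<in> ?U"
    using sobolev_space_nonzero[OF p(1) \<Omega>] by blast
  then have S: "S < \<infinity>"
    using sobolev_const_finite[OF setting, of u\<^sub>0 \<Omega>] by (simp add: S_def)
  have E: "ground_energy p \<Omega> W = (INF u\<in>?U. energy_quotient p \<Omega> W u)" for W
    by (simp add: ground_energy_def energy_quotient_def)
  have T: "(LINT x|lebesgue_on \<Omega>. W x powr q) powr (1 / \<gamma>) = t powr (1 + \<alpha>)"
    if "W \<in> borel_measurable (lebesgue_on \<Omega>)" "0 < t"
      "(\<integral>\<^sup>+x. ennreal (W x powr q) \<partial>lebesgue_on \<Omega>) = ennreal (t powr q)" for W t
  proof -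
    have "(LINT x|lebesgue_on \<Omega>. W x powr q) = t powr q"
      using that by (subst integral_eq_nn_integral) auto
    then show ?thesis
      using powr_inverse_exponent[OF setting that(2)] by simp
  qed
  let ?\<W> = "{W \<in> Lp_space (ennreal q) \<Omega>. (\<forall>x\<in>\<Omega>. 0 \<le> W x) \<and> \<not> ae_zero \<Omega> W}"
  let ?F = "\<lambda>W. (ground_energy p \<Omega> W + 1)
    / ereal ((LINT x|lebesgue_on \<Omega>. W x powr q) powr (1 / \<gamma>))"
  let ?R = "- ereal c * enn2ereal (ennpowr S (- ?a))"
  \<comment> \<open>For \<open>S = 0\<close> the right side is -\<infinity> and nothing is to be
    shown; otherwise the inequality for a single \<open>u\<close> passes to the infimum over
    \<open>u\<close>.\<close>
  have "?R \<le> ?F W" if "W \<in> ?\<W>" for W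
  proof (cases "S = 0")
    case True
    then have "ennpowr S (- ?a) = \<infinity>"
      using p \<alpha> by (simp add: ennpowr_def)
    then show ?thesis
      using c by simp
  next
    case False
    then obtain \<sigma> where \<sigma>: "S = ennreal \<sigma>" "0 < \<sigma>"
      using S by (cases S) auto
    have W: "W \<in> borel_measurable (lebesgue_on \<Omega>)" "\<And>x. x \<in> \<Omega> \<Longrightarrow> 0 \<le> W x"
      using that by (auto simp: Lp_space_def)
    have "Lp_norm (ennreal q) \<Omega> W \<noteq> 0"
      using Lp_norm_eq_0[OF W(1), of "ennreal q"] that qpos by auto
    moreover have "Lp_norm (ennreal q) \<Omega> W < \<infinity>"
      using that by (simp add: Lp_space_def)
    ultimately obtain t where t: "0 < t" "Lp_norm (ennreal q) \<Omega> W = ennreal t"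
      by (cases "Lp_norm (ennreal q) \<Omega> W") auto
    have "(\<integral>\<^sup>+x. ennreal (W x powr q) \<partial>lebesgue_on \<Omega>)
        = (\<integral>\<^sup>+x. ennreal (norm (W x) powr q) \<partial>lebesgue_on \<Omega>)"
      using W by (intro nn_integral_cong) simp
    also have "\<dots> = ennreal (t powr q)"
      using t qpos Lp_norm_ennreal_eq_iff by blast
    finally have tq: "(\<integral>\<^sup>+x. ennreal (W x powr q) \<partial>lebesgue_on \<Omega>) = ennreal (t powr q)" .
    let ?s = "t powr (1 + \<alpha>)"
    have "ereal (- c * \<sigma> powr - ?a * ?s - 1) \<le> ground_energy p \<Omega> W"
      unfolding E c_def
      using keller_inequality_le[OF setting \<sigma>[unfolded S_def] W t(1) tq]
      by (intro INF_greatest) auto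
    \<comment> \<open>The 1 subtracted in the bound cancels against the one in the numerator. The
      bound is a real number, so the ground energy is not -\<infinity>.\<close>
    then have "ereal (- c * \<sigma> powr - ?a) \<le> (ground_energy p \<Omega> W + 1) / ereal ?s"
      using t by (cases "ground_energy p \<Omega> W") (auto simp: field_simps one_ereal_def)
    moreover have "?R = ereal (- c * \<sigma> powr - ?a)"
      using \<sigma> by (simp add: ennpowr_ennreal)
    ultimately show ?thesis
      using T[OF W(1) t(1) tq] by simp
  qed
  then have lower: "?R \<le> (INF W\<in>?\<W>. ?F W)"
    by (intro INF_greatest)
  have upper: "(INF W\<in>?\<W>. ?F W) \<le> ereal (- c * y)"
    if y: "0 < y" "ennreal y < ennpowr S (- ?a)" for y
  proof -
    obtain u W t where u: "u \<in> sobolev_space p \<Omega>" "\<not> ae_zero \<Omega> u"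
      and W: "W \<in> borel_measurable (lebesgue_on \<Omega>)" "\<And>x. 0 \<le> W x" and t: "0 < t"
      "(\<integral>\<^sup>+x. ennreal (W x powr q) \<partial>lebesgue_on \<Omega>) = ennreal (t powr q)"
      and le: "energy_quotient p \<Omega> W u \<le> ereal (- c * y * t powr (1 + \<alpha>) - 1)"
      using keller_inequality_sharp[OF setting y[unfolded S_def]] unfolding c_def by blast
    let ?s = "t powr (1 + \<alpha>)"
    have norm: "Lp_norm (ennreal q) \<Omega> W = ennreal t"
      using t qpos W by (simp add: Lp_norm_ennreal_eq_iff)
    have "\<not> ae_zero \<Omega> W"
    proof
      assume "ae_zero \<Omega> W"
      then have "AE x in lebesgue_on \<Omega>. ennreal (W x powr q) = 0"
        unfolding ae_zero_def by eventually_elim simp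
      then have "(\<integral>\<^sup>+x. ennreal (W x powr q) \<partial>lebesgue_on \<Omega>) = 0"
        using W by (subst nn_integral_0_iff_AE) auto
      then show False
        using t by simp
    qed
    then have "W \<in> ?\<W>"
      using W norm by (simp add: Lp_space_def)
    then have "(INF W\<in>?\<W>. ?F W) \<le> ?F W"
      by (rule INF_lower)
    also have "\<dots> = (ground_energy p \<Omega> W + 1) / ereal ?s"
      using T[OF W(1) t] by simp
    also have "\<dots> \<le> (ereal (- c * y * ?s - 1) + 1) / ereal ?s"
    proof (intro ereal_divide_right_mono add_right_mono)
      have "ground_energy p \<Omega> W \<le> energy_quotient p \<Omega> W u"
        unfolding E using u by (intro INF_lower) auto
      then show "ground_energy p \<Omega> W \<le> ereal (- c * y * ?s - 1)"
        using le by (rule order_trans)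
    qed (use t in simp)
    also have "\<dots> = ereal (- c * y)"
      using t by (simp add: one_ereal_def)
    finally show ?thesis .
  qed
  have "(INF W\<in>?\<W>. ?F W) \<le> ?R"
  \<comment> \<open>It suffices to test \<open>w\<close> strictly between \<open>?R\<close> and 0.
    Such a \<open>w\<close> is real even if \<open>?R\<close> is -\<infinity>, and it has the form
    \<open>- c * y\<close> with \<open>y > 0\<close>, so that \<open>upper\<close> applies. The
    right side is negative because \<open>S\<close> is finite.\<close>
  proof (rule dense_ge_bounded)
    have "0 < ennpowr S (- ?a)"
      using S p \<alpha> by (cases S) (auto simp: ennpowr_def)
    then show "?R < 0"
      using c by (cases "ennpowr S (- ?a)") auto
  next
    fix w assume w: "?R < w" "w < 0"
    then obtain z where z: "w = ereal z" "z < 0"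
      by (cases w) auto
    have y: "0 < - z / c"
      using z c by (simp add: divide_neg_pos)
    have "ennreal (- z / c) < ennpowr S (- ?a)"
    proof (cases "ennpowr S (- ?a)")
      case (real P)
      then have "- c * P < z"
        using w z by simp
      then have "- z / c < P"
        using c by (simp add: field_simps)
      then have "ennreal (- z / c) < ennreal P"
        using y by (intro ennreal_lessI) auto
      then show ?thesis
        using real by simp
    qed simp
    from upper[OF y this] show "(INF W\<in>?\<W>. ?F W) \<le> w"
      using z c by simp
  qed
  with lower have "(INF W\<in>?\<W>. ?F W) = ?R"
    by (rule antisym[rotated])
  then show ?thesis
    unfolding q_def c(1) a S_def .
qed

end
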